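(* For every $\bar Q\in\mathbb{C}^{n\times n}$ and $\sigma>0$, $\mathbb{E}_{Q\sim\mathcal{N}(\bar Q,\sigma^2\mathrm{Id})}\Big(\frac{\mu_{\mathrm{av}}^2(Q)}{\|Q\|_F^2}\Big)\le\frac{en}{2\sigma^2}$.
   Context: $\|\cdot\|_F$ is the Frobenius norm. For $v\ne0$, $T_v=v^\perp\subset\mathbb{C}^n$, $P_{v^\perp}$ the orthogonal projection onto $T_v$, $A_{\lambda,v}=P_{v^\perp}(A-\lambda\mathrm{Id})|_{T_v}$, and $\mu(A,\lambda,v)=\|A\|_F\|A_{\lambda,v}^{-1}\|$ (operator norm; $\infty$ if not invertible). For a matrix $Q$ with $n$ pairwise distinct eigenvalues and eigenpairs $(\lambda_1,v_1),\dots,(\lambda_n,v_n)$, $\mu_{\mathrm{av}}(Q)=\big(\frac1n\sum_{j=1}^n\mu^2(Q,\lambda_j,v_j)\big)^{1/2}$; this is defined almost surely. $\mathcal{N}(\bar Q,\sigma^2\mathrm{Id})$ is the distribution on $\mathbb{C}^{n\times n}$ with independent entries $q_{ij}=\bar q_{ij}+z_{ij}$ where real and imaginary parts of $z_{ij}$ are i.i.d. $\mathcal{N}(0,\sigma^2/2)$, i.e. density $(\pi\sigma^2)^{-n^2}e^{-\|Q-\bar Q\|_F^2/\sigma^2}$. *)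

theory Defs
  imports "HOL-Analysis.Analysis"
begin

definition cinner :: "complex^'n \<Rightarrow> complex^'n \<Rightarrow> complex" where
  "cinner w v = (\<Sum>i\<in>UNIV. w$i * cnj (v$i))"

definition Tsp :: "complex^'n \<Rightarrow> (complex^'n) set" where
  "Tsp v = {w. cinner w v = 0}"

definition Pperp :: "complex^'n \<Rightarrow> complex^'n \<Rightarrow> complex^'n" where
  "Pperp v w = w - (cinner w v / cinner v v) *s v"

definition frob :: "complex^'n^'n \<Rightarrow> real" where
  "frob A = sqrt (\<Sum>i\<in>UNIV. \<Sum>j\<in>UNIV. (cmod (A$i$j))\<^sup>2)"

definition Alv :: "complex^'n^'n \<Rightarrow> complex \<Rightarrow> complex^'n \<Rightarrow> complex^'n \<Rightarrow> complex^'n" where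
  "Alv A lam v w = Pperp v (A *v w - lam *s w)"

text \<open>Operator norm of the inverse of A_{lambda,v} : T_v -> T_v; infinity if not invertible.
  (Sup of the empty set is 0, matching the zero space when n = 1.)\<close>
definition inv_opnorm :: "complex^'n^'n \<Rightarrow> complex \<Rightarrow> complex^'n \<Rightarrow> ennreal" where
  "inv_opnorm A lam v =
     (if bij_betw (Alv A lam v) (Tsp v) (Tsp v)
      then (SUP y\<in>Tsp v - {0}.
              ennreal (norm (inv_into (Tsp v) (Alv A lam v) y) / norm y))
      else top)"

definition mu :: "complex^'n^'n \<Rightarrow> complex \<Rightarrow> complex^'n \<Rightarrow> ennreal" where
  "mu A lam v = ennreal (frob A) * inv_opnorm A lam v"

definition eigvals :: "complex^'n^'n \<Rightarrow> complex set" where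
  "eigvals Q = {lam. \<exists>v. v \<noteq> 0 \<and> Q *v v = lam *s v}"

text \<open>mu_av^2(Q); defined when Q has n pairwise distinct eigenvalues, with
  v_j any eigenvector for lambda_j. Elsewhere (a null set) it is set to infinity,
  which only makes the statement stronger.\<close>
definition mu_av_sq :: "complex^'n^'n \<Rightarrow> ennreal" where
  "mu_av_sq Q =
     (if card (eigvals Q) = CARD('n)
      then (\<Sum>lam\<in>eigvals Q. (mu Q lam (SOME v. v \<noteq> 0 \<and> Q *v v = lam *s v))\<^sup>2)
             / ennreal (real CARD('n))
      else top)"

definition gauss_mat :: "complex^'n^'n \<Rightarrow> real \<Rightarrow> (complex^'n^'n) measure" where
  "gauss_mat Qbar \<sigma> = density lborel
     (\<lambda>Q. ennreal ((pi * \<sigma>\<^sup>2) powr (- real (CARD('n)^2)) * exp (- (frob (Q - Qbar))\<^sup>2 / \<sigma>\<^sup>2)))"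

end

(* For an index k, the rows of Q other than the k-th determine a polynomial curve v(z), the k-th
   column of adj(z - Q), of degree at most n - 1, and v(z) is an eigenvector whenever z is an
   eigenvalue. Let p be the characteristic polynomial of Q. Differentiating (z - Q) v = p e_k at a
   simple eigenvalue gives A_{z,v} (P v') = - p' P e_k, with P the projection onto the orthogonal
   complement of v; hence norm(A_{z,v}^{-1})^2 is at most the sum over k of |P v'|^2 / |p'|^2.

   Given the other rows, p(z) is an affine function of the Gaussian row k with variance s |v(z)|^2,
   s = sigma^2, so its density at 0 is at most 1 / (pi s |v(z)|^2). A Kac-Rice argument, with the
   Dirac mass at 0 replaced by narrow Gaussians so that Fatou's lemma suffices, then bounds the expected
   sum over the eigenvalues of |P v'|^2 / |p'|^2 by 1 / (pi s) times the integral of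
   |P v'|^2 / |v|^2, which is the Fubini-Study area of the curve and by Green's theorem at most
   pi (n - 1). Summing over k and dividing by n gives the bound (n - 1) / s, which is at most e n / (2 s). *)

theory Submission
  imports Defs "HOL-Probability.Distributions" "HOL-Computational_Algebra.Fundamental_Theorem_Algebra"
begin

section \<open>Gaussian densities\<close>

text \<open>Division by the squared Frobenius norm cancels that factor of \<open>mu\<close>, so only
  the norms of the inverses have to be bounded. Cofactors along row k do not see row k, which is why
  the k-th adjugate column is paired with a resampling of the k-th row. Only an upper bound is
  wanted, so zooming in at each root and taking a liminf replaces an area formula. The curve v may
  have zeros, where the Fubini-Study density is singular. The smoothing of the Dirac mass repairs
  this as well: its variance tau reappears as the constant e = tau / s added to |v|^2 in
  \<open>fs_den\<close>, and the area bound is uniform in e. The pointwise inequality needs simple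
  eigenvalues at which no v_k vanishes. Matrices violating this form a null set, because a line in
  the direction of one explicit good matrix D meets them finitely often: on the pencil D + w Q the
  bad parameters are roots of a polynomial that is nonzero at w = 0.\<close>

definition gdens :: "real \<Rightarrow> 'a::euclidean_space \<Rightarrow> real" where
  "gdens s x = (pi * s) powr (- (real DIM('a) / 2)) * exp (- (norm x)\<^sup>2 / s)"

lemma gdens_nonneg [simp]: "0 \<le> gdens s x"
  by (simp add: gdens_def)

lemma gdens_measurable [measurable]: "gdens s \<in> borel_measurable borel"
  unfolding gdens_def[abs_def] by measurable

lemma gdens_minus: "gdens s (- x) = gdens s x"
  by (simp add: gdens_def)

lemma gdens_complex: "s > 0 \<Longrightarrow> gdens s (z::complex) = exp (- (cmod z)\<^sup>2 / s) / (pi * s)"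
  by (simp add: gdens_def powr_minus field_simps)

lemma nn_integral_lborel_translate:
  fixes f :: "'a::euclidean_space \<Rightarrow> ennreal"
  assumes [measurable]: "f \<in> borel_measurable borel"
  shows "(\<integral>\<^sup>+x. f (x + a) \<partial>lborel) = (\<integral>\<^sup>+x. f x \<partial>lborel)"
proof -
  have "(\<integral>\<^sup>+x. f x \<partial>lborel) = (\<integral>\<^sup>+x. f x \<partial>distr lborel borel ((+) a))"
    by (simp add: lborel_distr_plus)
  also have "\<dots> = (\<integral>\<^sup>+x. f (a + x) \<partial>lborel)"
    by (subst nn_integral_distr) auto
  finally show ?thesis by (simp add: add.commute)
qed

lemma gdens_total:
  assumes s: "s > 0"
  shows "(\<integral>\<^sup>+x. ennreal (gdens s (x::'a::euclidean_space)) \<partial>lborel) = 1"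
proof -
  \<comment> \<open>The parameter \<open>s\<close> is twice the variance of a real coordinate, so
    for a complex variable it is the variance in the sense of E|z|^2.\<close>
  let ?\<sigma> = "sqrt (s/2)"
  have one: "(\<integral>\<^sup>+x. ennreal (normal_density 0 ?\<sigma> x) \<partial>lborel) = 1"
  proof -
    interpret prob_space "density lborel (normal_density 0 ?\<sigma>)"
      by (rule prob_space_normal_density) (use s in simp)
    show ?thesis using emeasure_space_1 by (simp add: emeasure_density)
  qed
  have nd: "normal_density 0 ?\<sigma> t = (pi * s) powr (-1/2) * exp (- t\<^sup>2 / s)" for t
    using s by (simp add: normal_density_def powr_minus powr_half_sqrt divide_simps)
  have "ennreal (gdens s x) = (\<Prod>b\<in>Basis. ennreal (normal_density 0 ?\<sigma> (x \<bullet> b)))" for x :: 'a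
  proof -
    have "(\<Prod>b\<in>(Basis::'a set). normal_density 0 ?\<sigma> (x \<bullet> b))
        = ((pi * s) powr (-1/2)) ^ DIM('a) * exp (\<Sum>b\<in>(Basis::'a set). - (x \<bullet> b)\<^sup>2 / s)"
      by (simp add: nd prod.distrib exp_sum)
    also have "((pi * s) powr (-1/2)) ^ DIM('a) = (pi * s) powr (- (real DIM('a) / 2))"
      using s by (simp add: powr_realpow[symmetric] powr_powr)
    also have "(\<Sum>b\<in>(Basis::'a set). - (x \<bullet> b)\<^sup>2 / s) = - (norm x)\<^sup>2 / s"
      unfolding power2_norm_eq_inner euclidean_inner[of x x]
      by (simp add: power2_eq_square sum_divide_distrib sum_negf)
    finally show ?thesis by (simp add: prod_ennreal gdens_def)
  qed
  then have "(\<integral>\<^sup>+x. ennreal (gdens s (x::'a)) \<partial>lborel)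
      = (\<Prod>b\<in>(Basis::'a set). (\<integral>\<^sup>+x. ennreal (normal_density 0 ?\<sigma> x) \<partial>lborel))"
    using nn_integral_lborel_prod[of "\<lambda>_ x. ennreal (normal_density 0 ?\<sigma> x)"] by simp
  then show ?thesis by (simp add: one)
qed

lemma gdens_total_shift:
  assumes s: "s > 0"
  shows "(\<integral>\<^sup>+x. ennreal (gdens s (x - m :: 'a::euclidean_space)) \<partial>lborel) = 1"
  using nn_integral_lborel_translate[of "\<lambda>x. ennreal (gdens s x)" "- m"] gdens_total[OF s] by simp

text \<open>The component \<open>P x\<close> of a Gaussian vector may be replaced by an independent copy. The proof only
  uses translations and Fubini's theorem, so no product decomposition of \<open>lborel\<close> is needed.\<close>

lemma gauss_resample:
  fixes J :: "'f::euclidean_space \<Rightarrow> 'e::euclidean_space" and P :: "'e \<Rightarrow> 'f"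
  assumes s: "s > 0" and J: "linear J" and P: "linear P" and PJ: "\<And>y. P (J y) = y"
    and pyth: "\<And>x. (norm x)\<^sup>2 = (norm (x - J (P x)))\<^sup>2 + (norm (P x))\<^sup>2"
    and H [measurable]: "H \<in> borel_measurable borel"
  shows "(\<integral>\<^sup>+x. H x * ennreal (gdens s (x - m)) \<partial>lborel)
    = (\<integral>\<^sup>+x. (\<integral>\<^sup>+y. H (x + J (y - P x)) * ennreal (gdens s (y - P m)) \<partial>lborel)
          * ennreal (gdens s (x - m)) \<partial>lborel)"
proof -
  have [measurable]: "J \<in> borel_measurable borel" "P \<in> borel_measurable borel"
    using J P by (auto intro!: borel_measurable_continuous_onI linear_continuous_on
        simp: linear_conv_bounded_linear)
  \<comment> \<open>The Gaussian factor of the component complementary to the range of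
    \<open>J\<close>, normalised for the remaining DIM('e) - DIM('f) dimensions. It is invariant
    under translation by \<open>J y\<close>.\<close>
  define r where "r x = (pi * s) powr (- (real DIM('e) / 2) + real DIM('f) / 2)
      * exp (- (norm (x - J (P x)))\<^sup>2 / s)" for x :: 'e
  have [measurable]: "r \<in> borel_measurable borel"
    unfolding r_def[abs_def] by measurable
  have r0: "r x \<ge> 0" for x by (simp add: r_def)
  have split: "gdens s x = r x * gdens s (P x)" for x
  proof -
    have "exp (- (norm x)\<^sup>2 / s) = exp (- (norm (x - J (P x)))\<^sup>2 / s) * exp (- (norm (P x))\<^sup>2 / s)"
      by (subst pyth) (simp add: exp_add[symmetric] diff_divide_distrib)
    moreover have "(pi * s) powr (- (real DIM('e) / 2))
      = (pi * s) powr (- (real DIM('e) / 2) + real DIM('f) / 2) * (pi * s) powr (- (real DIM('f) / 2))"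
      by (simp add: powr_add[symmetric])
    ultimately show ?thesis by (simp add: gdens_def r_def)
  qed
  have r_inv: "r (x - J y) = r x" for x y
    by (simp add: r_def linear_diff[OF J] linear_diff[OF P] PJ)
  have "(\<integral>\<^sup>+x. (\<integral>\<^sup>+y. H (x + J (y - P x)) * ennreal (gdens s (y - P m)) \<partial>lborel)
          * ennreal (gdens s (x - m)) \<partial>lborel)
     = (\<integral>\<^sup>+x. (\<integral>\<^sup>+y. H (x + J y) * ennreal (gdens s (y + P x - P m)) \<partial>lborel)
          * ennreal (gdens s (x - m)) \<partial>lborel)"
  proof (rule nn_integral_cong, rule arg_cong2[where f="(*)"])
    fix x
    show "(\<integral>\<^sup>+y. H (x + J (y - P x)) * ennreal (gdens s (y - P m)) \<partial>lborel)
        = (\<integral>\<^sup>+y. H (x + J y) * ennreal (gdens s (y + P x - P m)) \<partial>lborel)"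
      using nn_integral_lborel_translate[of "\<lambda>y. H (x + J (y - P x)) * ennreal (gdens s (y - P m))" "P x"]
      by simp
    show "ennreal (gdens s (x - m)) = ennreal (gdens s (x - m))" ..
  qed
  also have "\<dots> = (\<integral>\<^sup>+x. (\<integral>\<^sup>+y. H (x + J y) * ennreal (gdens s (y + P x - P m)) * ennreal (gdens s (x - m)) \<partial>lborel) \<partial>lborel)"
    by (intro nn_integral_cong nn_integral_multc[symmetric]) simp
  also have "\<dots> = (\<integral>\<^sup>+y. (\<integral>\<^sup>+x. H (x + J y) * ennreal (gdens s (y + P x - P m)) * ennreal (gdens s (x - m)) \<partial>lborel) \<partial>lborel)"
    by (rule lborel_pair.Fubini') simp
  \<comment> \<open>Translating by \<open>J y\<close> frees \<open>H\<close> of the variable y,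
    which survives only in a Gaussian density centred at \<open>P x - P m\<close>; that density has
    mass 1.\<close>
  also have "\<dots> = (\<integral>\<^sup>+y. (\<integral>\<^sup>+x. H x * ennreal (gdens s (P x - P m)) * ennreal (gdens s (x - J y - m)) \<partial>lborel) \<partial>lborel)"
  proof (rule nn_integral_cong)
    fix y
    show "(\<integral>\<^sup>+x. H (x + J y) * ennreal (gdens s (y + P x - P m)) * ennreal (gdens s (x - m)) \<partial>lborel)
      = (\<integral>\<^sup>+x. H x * ennreal (gdens s (P x - P m)) * ennreal (gdens s (x - J y - m)) \<partial>lborel)"
      using nn_integral_lborel_translate[of
          "\<lambda>x. H x * ennreal (gdens s (P x - P m)) * ennreal (gdens s (x - J y - m))" "J y"]
      by (simp add: linear_add[OF P] PJ algebra_simps)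
  qed
  also have "\<dots> = (\<integral>\<^sup>+x. (\<integral>\<^sup>+y. H x * ennreal (gdens s (P x - P m)) * ennreal (gdens s (x - J y - m)) \<partial>lborel) \<partial>lborel)"
    by (rule lborel_pair.Fubini') simp
  also have "\<dots> = (\<integral>\<^sup>+x. H x * ennreal (gdens s (x - m)) \<partial>lborel)"
  proof (rule nn_integral_cong)
    fix x
    have "(\<integral>\<^sup>+y. H x * ennreal (gdens s (P x - P m)) * ennreal (gdens s (x - J y - m)) \<partial>lborel)
      = (\<integral>\<^sup>+y. (H x * ennreal (gdens s (P x - P m)) * ennreal (r (x - m))) * ennreal (gdens s (y - (P x - P m))) \<partial>lborel)"
    proof (rule nn_integral_cong)
      fix y
      have "x - J y - m = (x - m) - J y" by simp
      then have "gdens s (x - J y - m) = r (x - m) * gdens s (P ((x - m) - J y))"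
        by (simp only: split r_inv)
      also have "P ((x - m) - J y) = - (y - (P x - P m))"
        by (simp add: linear_diff[OF P] PJ)
      finally have "gdens s (x - J y - m) = r (x - m) * gdens s (y - (P x - P m))"
        by (simp only: gdens_minus)
      then show "H x * ennreal (gdens s (P x - P m)) * ennreal (gdens s (x - J y - m))
         = (H x * ennreal (gdens s (P x - P m)) * ennreal (r (x - m))) * ennreal (gdens s (y - (P x - P m)))"
        by (simp add: ennreal_mult r0 mult.assoc)
    qed
    also have "\<dots> = H x * ennreal (gdens s (P x - P m)) * ennreal (r (x - m))"
      by (simp add: nn_integral_cmult gdens_total_shift[OF s])
    also have "\<dots> = H x * ennreal (gdens s (x - m))"
      by (simp add: split[of "x - m"] linear_diff[OF P] ennreal_mult r0 mult_ac)
    finally show "(\<integral>\<^sup>+y. H x * ennreal (gdens s (P x - P m)) * ennreal (gdens s (x - J y - m)) \<partial>lborel)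
        = H x * ennreal (gdens s (x - m))" .
  qed
  finally show ?thesis ..
qed

section \<open>Densities of linear forms in complex Gaussian variables\<close>

lemma complete_square_rescale:
  fixes x z c w \<tau> s t :: real
  assumes "\<tau> > 0" "s > 0" "t > 0" and id: "t * (s * x + \<tau> * z) = \<tau> * s * c + t\<^sup>2 * w"
  shows "x / \<tau> + z / s = c / t + w / (\<tau> * s / t)"
proof -
  have "x / \<tau> + z / s = t * (s * x + \<tau> * z) / (\<tau> * s * t)"
    using assms(1-3) by (simp add: add_divide_distrib distrib_left)
  also have "\<dots> = c / t + w / (\<tau> * s / t)"
    unfolding id using assms(1-3) by (simp add: add_divide_distrib power2_eq_square)
  finally show ?thesis .
qed

text \<open>Completing the square. In probabilistic terms, the joint density of z and of z u plus
  noise of variance \<open>\<tau>\<close> is rewritten as the marginal of the sum, of variance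
  \<open>t\<close>, times the conditional density of z, which has mean (s / t) \<open>cnj u\<close>
  c and variance \<open>\<tau>\<close> s / t.\<close>

lemma gdens_complex_mult:
  fixes c u z :: complex
  assumes \<tau>: "\<tau> > 0" and s: "s > 0"
  defines "t \<equiv> \<tau> + s * (cmod u)\<^sup>2"
  shows "gdens \<tau> (c - z * u) * gdens s z
    = gdens t c * gdens (\<tau> * s / t) (z - of_real (s / t) * cnj u * c)"
proof -
  have t: "t > 0" unfolding t_def using \<tau> s by (simp add: add_pos_nonneg)
  have id: "t * (s * (cmod (c - z * u))\<^sup>2 + \<tau> * (cmod z)\<^sup>2)
      = \<tau> * s * (cmod c)\<^sup>2 + (cmod (of_real t * z - of_real s * cnj u * c))\<^sup>2"
    unfolding t_def cmod_power2 by (simp add: power2_eq_square algebra_simps)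
  have "of_real t * z - of_real s * cnj u * c = of_real t * (z - of_real (s / t) * cnj u * c)"
    using t by (simp add: field_simps)
  then have "(cmod (of_real t * z - of_real s * cnj u * c))\<^sup>2 = t\<^sup>2 * (cmod (z - of_real (s / t) * cnj u * c))\<^sup>2"
    by (simp only: norm_mult power_mult_distrib) (use t in simp)
  with id have "t * (s * (cmod (c - z * u))\<^sup>2 + \<tau> * (cmod z)\<^sup>2)
      = \<tau> * s * (cmod c)\<^sup>2 + t\<^sup>2 * (cmod (z - of_real (s / t) * cnj u * c))\<^sup>2"
    by (simp only:)
  from complete_square_rescale[OF \<tau> s t this]
  have e: "- (cmod (c - z * u))\<^sup>2 / \<tau> + - (cmod z)\<^sup>2 / s
      = - (cmod c)\<^sup>2 / t + - (cmod (z - of_real (s / t) * cnj u * c))\<^sup>2 / (\<tau> * s / t)"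
    by (simp only: minus_divide_left[symmetric] minus_add_distrib[symmetric])
  then have "exp (- (cmod (c - z * u))\<^sup>2 / \<tau>) * exp (- (cmod z)\<^sup>2 / s)
      = exp (- (cmod c)\<^sup>2 / t) * exp (- (cmod (z - of_real (s / t) * cnj u * c))\<^sup>2 / (\<tau> * s / t))"
    unfolding exp_add[symmetric] e ..
  moreover have "\<tau> * s / t > 0" "pi * t * (pi * (\<tau> * s / t)) = pi * \<tau> * (pi * s)" using t \<tau> s by simp_all
  ultimately show ?thesis
    by (simp only: gdens_complex[OF \<tau>] gdens_complex[OF s] gdens_complex[OF t] gdens_complex times_divide_times_eq)
qed

lemma gdens_complex_convolution:
  fixes c u m :: complex
  assumes \<tau>: "\<tau> > 0" and s: "s > 0"
  shows "(\<integral>\<^sup>+z. ennreal (gdens \<tau> (c - z * u)) * ennreal (gdens s (z - m)) \<partial>lborel)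
    = ennreal (gdens (\<tau> + s * (cmod u)\<^sup>2) (c - m * u))"
proof -
  define t where "t = \<tau> + s * (cmod u)\<^sup>2"
  have t: "t > 0" unfolding t_def using \<tau> s by (simp add: add_pos_nonneg)
  have "(\<integral>\<^sup>+z. ennreal (gdens \<tau> (c - z * u)) * ennreal (gdens s (z - m)) \<partial>lborel)
     = (\<integral>\<^sup>+z. ennreal (gdens \<tau> (c - (z + m) * u)) * ennreal (gdens s z) \<partial>lborel)"
    using nn_integral_lborel_translate[of "\<lambda>z. ennreal (gdens \<tau> (c - z * u)) * ennreal (gdens s (z - m))" m]
    by simp
  also have "\<dots> = (\<integral>\<^sup>+z. ennreal (gdens t (c - m * u))
      * ennreal (gdens (\<tau> * s / t) (z - of_real (s / t) * cnj u * (c - m * u))) \<partial>lborel)"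
  proof (rule nn_integral_cong)
    fix z
    have "c - (z + m) * u = (c - m * u) - z * u" by (simp add: algebra_simps)
    show "ennreal (gdens \<tau> (c - (z + m) * u)) * ennreal (gdens s z) = ennreal (gdens t (c - m * u))
      * ennreal (gdens (\<tau> * s / t) (z - of_real (s / t) * cnj u * (c - m * u)))"
      unfolding \<open>c - (z + m) * u = (c - m * u) - z * u\<close>
      using gdens_complex_mult[OF \<tau> s, of "c - m * u" z u]
      by (simp add: ennreal_mult[symmetric] t_def)
  qed
  also have "\<dots> = ennreal (gdens t (c - m * u))"
    using t \<tau> s by (simp add: nn_integral_cmult gdens_total_shift)
  finally show ?thesis by (simp add: t_def)
qed

lemma norm_power2_vec: "(norm (x :: 'a::real_normed_vector^'n))\<^sup>2 = (\<Sum>i\<in>UNIV. (norm (x $ i))\<^sup>2)"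
  by (simp add: norm_vec_def L2_set_def sum_nonneg)

lemma gauss_resample_component:
  fixes H :: "('a::euclidean_space)^'n \<Rightarrow> ennreal"
  assumes s: "s > 0" and H: "H \<in> borel_measurable borel"
  shows "(\<integral>\<^sup>+x. H x * ennreal (gdens s (x - m)) \<partial>lborel)
    = (\<integral>\<^sup>+x. (\<integral>\<^sup>+y. H (x + axis k (y - x $ k)) * ennreal (gdens s (y - m $ k)) \<partial>lborel)
          * ennreal (gdens s (x - m)) \<partial>lborel)"
proof (rule gauss_resample[OF s])
  show "linear (axis k :: 'a \<Rightarrow> 'a^'n)"
    by (auto intro!: linearI simp: axis_def vec_eq_iff)
  show "linear (\<lambda>x::'a^'n. x $ k)"
    by (auto intro!: linearI)
  show "(norm x)\<^sup>2 = (norm (x - axis k (x $ k)))\<^sup>2 + (norm (x $ k))\<^sup>2" for x :: "'a^'n"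
    unfolding norm_power2_vec by (simp add: sum.remove[of UNIV k] axis_def)
qed (simp add: axis_def, rule H)

text \<open>The left side is the density at c of the linear form plus independent noise of variance
  \<open>\<tau>\<close>. This sum is Gaussian, its variance is the denominator without pi, and a
  complex Gaussian density is largest at its mean, with value 1 / (pi times variance).\<close>

lemma gauss_linear_form_density_le:
  fixes ybar :: "complex^'n" and u :: "'n \<Rightarrow> complex"
  assumes s: "s > 0" and \<tau>: "\<tau> > 0"
  shows "(\<integral>\<^sup>+y. ennreal (gdens \<tau> (c - (\<Sum>i\<in>S. y $ i * u i))) * ennreal (gdens s (y - ybar)) \<partial>lborel)
    \<le> ennreal (1 / (pi * (\<tau> + s * (\<Sum>i\<in>S. (cmod (u i))\<^sup>2))))"
proof -
  have "finite S" by simp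
  then show ?thesis using \<tau>
  proof (induction S arbitrary: c \<tau>)
    case empty
    have "gdens \<tau> c \<le> 1 / (pi * \<tau>)"
      using empty by (simp add: gdens_complex divide_simps)
    then show ?case
      by (simp add: nn_integral_cmult gdens_total_shift[OF s] ennreal_leI)
  next
    case (insert k S)
    let ?H = "\<lambda>\<tau> c S y. ennreal (gdens \<tau> (c - (\<Sum>i\<in>S. y $ i * u i)))"
    have [measurable]: "(\<lambda>y. ?H \<tau> c (insert k S) (y::complex^'n)) \<in> borel_measurable borel"
      by (intro measurable_compose[OF _ measurable_ennreal] measurable_compose[OF _ gdens_measurable]
          borel_measurable_continuous_onI continuous_intros)
    have sum_axis: "(\<Sum>i\<in>insert k S. (y + axis k (z - y $ k)) $ i * u i) = (\<Sum>i\<in>S. y $ i * u i) + z * u k"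
      for y :: "complex^'n" and z
      using insert.hyps by (subst sum.insert) (auto simp: axis_def intro!: sum.cong)
    have "(\<integral>\<^sup>+y. ?H \<tau> c (insert k S) y * ennreal (gdens s (y - ybar)) \<partial>lborel)
      = (\<integral>\<^sup>+y. (\<integral>\<^sup>+z. ?H \<tau> c (insert k S) (y + axis k (z - y $ k)) * ennreal (gdens s (z - ybar $ k)) \<partial>lborel)
          * ennreal (gdens s (y - ybar)) \<partial>lborel)"
    by (rule gauss_resample_component[OF s]) measurable
    \<comment> \<open>Integrating out coordinate k adds its variance to the noise and moves its mean
      into the constant, so the induction must hold for all \<open>c\<close> and
      \<open>\<tau>\<close>.\<close>
    also have "\<dots> = (\<integral>\<^sup>+y. ?H (\<tau> + s * (cmod (u k))\<^sup>2) (c - ybar $ k * u k) S y * ennreal (gdens s (y - ybar)) \<partial>lborel)"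
    proof (rule nn_integral_cong, rule arg_cong2[where f="(*)"])
      fix y :: "complex^'n"
      show "(\<integral>\<^sup>+z. ?H \<tau> c (insert k S) (y + axis k (z - y $ k)) * ennreal (gdens s (z - ybar $ k)) \<partial>lborel)
        = ?H (\<tau> + s * (cmod (u k))\<^sup>2) (c - ybar $ k * u k) S y"
        unfolding sum_axis
        using gdens_complex_convolution[OF insert.prems s, of "c - (\<Sum>i\<in>S. y $ i * u i)" "u k" "ybar $ k"]
        by (simp add: algebra_simps)
      show "ennreal (gdens s (y - ybar)) = ennreal (gdens s (y - ybar))" ..
    qed
    also have "\<dots> \<le> ennreal (1 / (pi * (\<tau> + s * (cmod (u k))\<^sup>2 + s * (\<Sum>i\<in>S. (cmod (u i))\<^sup>2))))"
      using insert.prems s by (intro insert.IH) (simp add: add_pos_nonneg)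
    finally show ?case using insert.hyps by (simp add: algebra_simps)
  qed
qed

section \<open>The area of a polynomial curve\<close>

lemma lborel_complex_eq: "lborel = distr (lborel \<Otimes>\<^sub>M lborel) borel (\<lambda>(x, y). Complex x y)"
proof (rule lborel_eqI)
  have [measurable]: "(\<lambda>(x, y). Complex x y) \<in> borel_measurable (lborel \<Otimes>\<^sub>M lborel)"
    unfolding lborel_prod measurable_lborel2 split_def
    by (intro borel_measurable_continuous_onI) (auto intro!: continuous_intros simp: Complex_eq)
  fix l u :: complex assume lu: "\<And>b. b \<in> Basis \<Longrightarrow> l \<bullet> b \<le> u \<bullet> b"
  have le: "Re l \<le> Re u" "Im l \<le> Im u"
    using lu[of 1] lu[of \<i>] by (auto simp: Basis_complex_def)
  have "(\<lambda>(x, y). Complex x y) -` box l u \<inter> space (lborel \<Otimes>\<^sub>M lborel)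
      = {Re l <..< Re u} \<times> {Im l <..< Im u}"
    by (auto simp: box_def Basis_complex_def space_pair_measure)
  then show "emeasure (distr (lborel \<Otimes>\<^sub>M lborel) borel (\<lambda>(x, y). Complex x y)) (box l u)
      = ennreal (\<Prod>b\<in>Basis. (u - l) \<bullet> b)"
    using le by (simp add: emeasure_distr lborel.emeasure_pair_measure_Times Basis_complex_def ennreal_mult)
qed simp

lemma nn_integral_lborel_complex:
  assumes [measurable]: "f \<in> borel_measurable borel"
  shows "(\<integral>\<^sup>+z. f z \<partial>lborel) = (\<integral>\<^sup>+x. \<integral>\<^sup>+y. f (Complex x y) \<partial>lborel \<partial>lborel)"
proof -
  have m [measurable]: "(\<lambda>(x, y). Complex x y) \<in> borel_measurable (lborel \<Otimes>\<^sub>M lborel)"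
    unfolding lborel_prod measurable_lborel2 split_def
    by (intro borel_measurable_continuous_onI) (auto intro!: continuous_intros simp: Complex_eq)
  have "(\<integral>\<^sup>+z. f z \<partial>lborel) = (\<integral>\<^sup>+z. f z \<partial>distr (lborel \<Otimes>\<^sub>M lborel) borel (\<lambda>(x, y). Complex x y))"
    using lborel_complex_eq by simp
  also have "\<dots> = (\<integral>\<^sup>+p. f (case p of (x, y) \<Rightarrow> Complex x y) \<partial>(lborel \<Otimes>\<^sub>M lborel))"
    by (intro nn_integral_distr m) simp
  also have "\<dots> = (\<integral>\<^sup>+x. \<integral>\<^sup>+y. f (Complex x y) \<partial>lborel \<partial>lborel)"
    by (subst lborel.nn_integral_fst[symmetric]) simp_all
  finally show ?thesis .
qed

lemma tendsto_poly_div_power: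
  fixes p :: "'a::real_normed_field poly"
  assumes "degree p \<le> d"
  shows "((\<lambda>z. poly p z / z ^ d) \<longlongrightarrow> coeff p d) at_infinity"
proof (cases "degree p = d")
  case True then show ?thesis using poly_divide_tendsto_aux[of p] by simp
next
  case False
  then have lt: "degree p < d" using assms by simp
  have "((\<lambda>z. poly p z / poly (monom 1 d) z) \<longlongrightarrow> 0) at_infinity"
    by (rule poly_divide_tendsto_0_at_infinity) (use lt in \<open>simp add: degree_monom_eq\<close>)
  then show ?thesis using lt by (simp add: poly_monom coeff_eq_0)
qed

text \<open>For a polynomial curve \<open>p\<close>, \<open>fs_dens e p\<close> is the mixed Wirtinger derivative of
  \<open>ln (e + |p|\<^sup>2)\<close>, the Fubini-Study area density at \<open>e = 0\<close>, and \<open>fs_theta\<close> is the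
  holomorphic Wirtinger derivative. Taking \<open>e > 0\<close> avoids common zeros of the components.\<close>

definition fs_num :: "('n::finite \<Rightarrow> complex poly) \<Rightarrow> complex \<Rightarrow> complex" where
  "fs_num p z = (\<Sum>i\<in>UNIV. poly (pderiv (p i)) z * cnj (poly (p i) z))"

definition fs_den :: "real \<Rightarrow> ('n::finite \<Rightarrow> complex poly) \<Rightarrow> complex \<Rightarrow> real" where
  "fs_den e p z = e + (\<Sum>i\<in>UNIV. (cmod (poly (p i) z))\<^sup>2)"

definition fs_dens :: "real \<Rightarrow> ('n::finite \<Rightarrow> complex poly) \<Rightarrow> complex \<Rightarrow> real" where
  "fs_dens e p z = (\<Sum>i\<in>UNIV. (cmod (poly (pderiv (p i)) z))\<^sup>2) / fs_den e p z
     - (cmod (fs_num p z))\<^sup>2 / (fs_den e p z)\<^sup>2"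

definition fs_theta :: "real \<Rightarrow> ('n::finite \<Rightarrow> complex poly) \<Rightarrow> complex \<Rightarrow> complex" where
  "fs_theta e p z = fs_num p z / of_real (fs_den e p z)"

lemma fs_den_pos: "e > 0 \<Longrightarrow> fs_den e p z > 0"
  by (simp add: fs_den_def add_pos_nonneg sum_nonneg)

lemma fs_den_nz: "e > 0 \<Longrightarrow> fs_den e p z \<noteq> 0"
  using fs_den_pos[of e p z] by simp

lemma fs_den_complex: "of_real (fs_den e p z) = of_real e + (\<Sum>i\<in>UNIV. poly (p i) z * cnj (poly (p i) z))"
  by (simp only: fs_den_def of_real_add of_real_sum complex_norm_square)

lemma cauchy_schwarz_sum_complex:
  fixes a b :: "'n::finite \<Rightarrow> complex"
  shows "(cmod (\<Sum>i\<in>UNIV. a i * cnj (b i)))\<^sup>2 \<le> (\<Sum>i\<in>UNIV. (cmod (a i))\<^sup>2) * (\<Sum>i\<in>UNIV. (cmod (b i))\<^sup>2)"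
proof -
  have "cmod (\<Sum>i\<in>UNIV. a i * cnj (b i)) \<le> (\<Sum>i\<in>UNIV. \<bar>cmod (a i)\<bar> * \<bar>cmod (b i)\<bar>)"
    by (rule order_trans[OF norm_sum]) (simp add: norm_mult)
  also have "\<dots> \<le> L2_set (\<lambda>i. cmod (a i)) UNIV * L2_set (\<lambda>i. cmod (b i)) UNIV"
    by (rule L2_set_mult_ineq)
  finally have "(cmod (\<Sum>i\<in>UNIV. a i * cnj (b i)))\<^sup>2 \<le> (L2_set (\<lambda>i. cmod (a i)) UNIV * L2_set (\<lambda>i. cmod (b i)) UNIV)\<^sup>2"
    by (intro power_mono) auto
  then show ?thesis by (simp add: power_mult_distrib L2_set_def sum_nonneg)
qed

lemma fs_dens_nonneg:
  assumes e: "e > 0" shows "fs_dens e p z \<ge> 0"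
proof -
  let ?A = "\<Sum>i\<in>UNIV. (cmod (poly (pderiv (p i)) z))\<^sup>2"
  let ?D = "fs_den e p z"
  have D: "?D > 0" by (rule fs_den_pos[OF e])
  have "(cmod (fs_num p z))\<^sup>2 \<le> ?A * (\<Sum>i\<in>UNIV. (cmod (poly (p i) z))\<^sup>2)"
    unfolding fs_num_def by (rule cauchy_schwarz_sum_complex)
  also have "\<dots> \<le> ?A * ?D"
    unfolding fs_den_def using e by (intro mult_left_mono) (auto intro: sum_nonneg)
  finally have "(cmod (fs_num p z))\<^sup>2 / ?D\<^sup>2 \<le> ?A * ?D / ?D\<^sup>2"
    by (rule divide_right_mono) simp
  also have "\<dots> = ?A / ?D" using D by (simp add: power2_eq_square)
  finally show ?thesis by (simp add: fs_dens_def)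
qed

lemma continuous_on_fs_num [continuous_intros]: "continuous_on S f \<Longrightarrow> continuous_on S (\<lambda>x. fs_num p (f x))"
  unfolding fs_num_def by (intro continuous_intros)

lemma continuous_on_fs_den [continuous_intros]: "continuous_on S f \<Longrightarrow> continuous_on S (\<lambda>x. fs_den e p (f x))"
  unfolding fs_den_def by (intro continuous_intros)

lemma continuous_on_fs_dens [continuous_intros]:
  "e > 0 \<Longrightarrow> continuous_on S f \<Longrightarrow> continuous_on S (\<lambda>x. fs_dens e p (f x))"
  unfolding fs_dens_def
  by (intro continuous_intros) (auto simp: fs_den_nz)

lemma continuous_on_fs_theta [continuous_intros]:
  "e > 0 \<Longrightarrow> continuous_on S f \<Longrightarrow> continuous_on S (\<lambda>x. fs_theta e p (f x))"
  unfolding fs_theta_def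
  by (intro continuous_intros) (auto simp: fs_den_nz)

text \<open>The derivative of \<open>fs_theta\<close> along the real line in direction \<open>h\<close>.\<close>

definition fs_theta' :: "real \<Rightarrow> ('n::finite \<Rightarrow> complex poly) \<Rightarrow> complex \<Rightarrow> complex \<Rightarrow> complex" where
  "fs_theta' e p h z =
    ((\<Sum>i\<in>UNIV. h * poly (pderiv (pderiv (p i))) z * cnj (poly (p i) z)
        + poly (pderiv (p i)) z * cnj (h * poly (pderiv (p i)) z)) * of_real (fs_den e p z)
      - fs_num p z * (h * fs_num p z + cnj (h * fs_num p z))) / (of_real (fs_den e p z))\<^sup>2"

lemma continuous_on_fs_theta' [continuous_intros]:
  "e > 0 \<Longrightarrow> continuous_on S f \<Longrightarrow> continuous_on S (\<lambda>x. fs_theta' e p h (f x))"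
  unfolding fs_theta'_def
  by (intro continuous_intros) (auto simp: fs_den_nz)

lemma has_vector_derivative_poly_line:
  fixes q :: "complex poly"
  shows "((\<lambda>t. poly q (c + of_real t * h)) has_vector_derivative h * poly (pderiv q) (c + of_real t * h)) (at t within S)"
proof -
  have "((\<lambda>t. c + of_real t * h) has_vector_derivative h) (at t within S)"
    unfolding has_vector_derivative_def
    using bounded_linear_imp_has_derivative[OF bounded_linear_compose[OF bounded_linear_mult_left[of h] bounded_linear_of_real]]
    by (auto intro!: derivative_eq_intros simp: scaleR_conv_of_real)
  from field_vector_diff_chain_within[OF this, of "poly q" "poly (pderiv q) (c + of_real t * h)"]
  show ?thesis by (simp add: o_def has_field_derivative_at_within)
qed

lemma has_vector_derivative_fs_theta:
  assumes e: "e > 0"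
  shows "((\<lambda>t. fs_theta e p (c + of_real t * h)) has_vector_derivative fs_theta' e p h (c + of_real t * h)) (at t within S)"
proof -
  let ?z = "\<lambda>t. c + of_real t * h"
  note d = has_vector_derivative_poly_line[where c=c and h=h and t=t and S=S]
  have dn: "((\<lambda>t. fs_num p (?z t)) has_vector_derivative
      (\<Sum>i\<in>UNIV. poly (pderiv (p i)) (?z t) * cnj (h * poly (pderiv (p i)) (?z t))
       + h * poly (pderiv (pderiv (p i))) (?z t) * cnj (poly (p i) (?z t)))) (at t within S)"
    unfolding fs_num_def
    by (intro has_vector_derivative_sum has_vector_derivative_mult has_vector_derivative_cnj d)
  have dd: "((\<lambda>t. of_real (fs_den e p (?z t)) :: complex) has_vector_derivative
      (0 + (\<Sum>i\<in>UNIV. poly (p i) (?z t) * cnj (h * poly (pderiv (p i)) (?z t))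
       + h * poly (pderiv (p i)) (?z t) * cnj (poly (p i) (?z t))))) (at t within S)"
    unfolding fs_den_complex
    by (intro has_vector_derivative_add has_vector_derivative_const has_vector_derivative_sum
        has_vector_derivative_mult has_vector_derivative_cnj d)
  have nz: "of_real (fs_den e p (?z t)) \<noteq> (0::complex)"
    using fs_den_pos[OF e, of p "?z t"] by simp
  have eq: "0 + (\<Sum>i\<in>UNIV. poly (p i) (?z t) * cnj (h * poly (pderiv (p i)) (?z t))
       + h * poly (pderiv (p i)) (?z t) * cnj (poly (p i) (?z t)))
      = h * fs_num p (?z t) + cnj (h * fs_num p (?z t))"
    by (simp add: fs_num_def sum.distrib sum_distrib_left mult_ac)
  show ?thesis
    unfolding has_vector_derivative_def fs_theta_def
    by (rule has_derivative_eq_rhs[OF has_derivative_divide'[OF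
          dn[unfolded has_vector_derivative_def] dd[unfolded has_vector_derivative_def eq] nz]])
      (simp add: fun_eq_iff fs_theta'_def scaleR_conv_of_real power2_eq_square algebra_simps sum_distrib_left)
qed

text \<open>The combination d/dx + i d/dy is twice the antiholomorphic Wirtinger derivative. Terms
  linear in h cancel because 1 * 1 + i * i = 0, whereas terms linear in the conjugate of h
  double.\<close>

lemma fs_theta_dbar:
  assumes e: "e > 0"
  shows "fs_theta' e p 1 z + \<i> * fs_theta' e p \<i> z = 2 * of_real (fs_dens e p z)"
proof -
  let ?D = "of_real (fs_den e p z) :: complex"
  let ?N = "fs_num p z"
  let ?a = "\<Sum>i\<in>UNIV. poly (pderiv (pderiv (p i))) z * cnj (poly (p i) z)"
  let ?b = "\<Sum>i\<in>UNIV. poly (pderiv (p i)) z * cnj (poly (pderiv (p i)) z)"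
  have D: "?D \<noteq> 0" using fs_den_pos[OF e, of p z] by simp
  have t: "fs_theta' e p h z = ((h * ?a + cnj h * ?b) * ?D - ?N * (h * ?N + cnj (h * ?N))) / ?D\<^sup>2" for h
    by (simp add: fs_theta'_def sum.distrib sum_distrib_left mult_ac)
  have "fs_theta' e p 1 z + \<i> * fs_theta' e p \<i> z = 2 * ((?b * ?D - ?N * cnj ?N) / ?D\<^sup>2)"
    unfolding t by (simp add: add_divide_distrib[symmetric] algebra_simps)
  also have "(?b * ?D - ?N * cnj ?N) / ?D\<^sup>2 = ?b / ?D - ?N * cnj ?N / ?D\<^sup>2"
    using D by (simp add: field_simps power2_eq_square)
  also have "\<dots> = of_real (fs_dens e p z)"
    unfolding fs_dens_def
    by (simp only: of_real_diff of_real_divide of_real_sum complex_norm_square) (simp only: of_real_power)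
  finally show ?thesis .
qed

text \<open>Green's theorem. On a square it reduces to the fundamental theorem of calculus in each
  coordinate and one exchange of integrals, and the right side is the flux through the four
  sides.\<close>

lemma fs_theta_square_identity:
  fixes R :: real
  assumes e: "e > 0" and R: "R > 0"
  defines "X \<equiv> {-R..R}"
  shows "integral X (\<lambda>x. integral X (\<lambda>y. 2 * complex_of_real (fs_dens e p (Complex x y))))
    = integral X (\<lambda>t. (fs_theta e p (Complex R t) - fs_theta e p (Complex (-R) t))
        + \<i> * (fs_theta e p (Complex t R) - fs_theta e p (Complex t (-R))))"
proof -
  note eq = Complex_eq
  have c: "continuous_on S (\<lambda>x. fs_theta' e p h (Complex (f x) (g x)))"
    if "continuous_on S f" "continuous_on S g" for S :: "'c::topological_space set" and f g h
    unfolding eq using e that by (auto intro!: continuous_intros)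
  have c0: "continuous_on S (\<lambda>x. fs_theta e p (Complex (f x) (g x)))"
    if "continuous_on S f" "continuous_on S g" for S :: "'c::topological_space set" and f g
    unfolding eq using e that by (auto intro!: continuous_intros)
  have ii: "f integrable_on X" if "continuous_on X f" for f :: "real \<Rightarrow> complex"
    unfolding X_def by (rule integrable_continuous_interval) (use that in \<open>simp add: X_def\<close>)
  have ftcx: "integral X (\<lambda>x. fs_theta' e p 1 (Complex x y)) = fs_theta e p (Complex R y) - fs_theta e p (Complex (-R) y)" for y
  proof -
    have "((\<lambda>x. fs_theta' e p 1 (of_real y * \<i> + of_real x * 1)) has_integral
       fs_theta e p (of_real y * \<i> + of_real R * 1) - fs_theta e p (of_real y * \<i> + of_real (-R) * 1)) {-R..R}"
      by (intro fundamental_theorem_of_calculus has_vector_derivative_fs_theta e) (use R in simp)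
    then show ?thesis by (simp add: X_def eq add.commute mult.commute integral_unique)
  qed
  have ftcy: "integral X (\<lambda>y. fs_theta' e p \<i> (Complex x y)) = fs_theta e p (Complex x R) - fs_theta e p (Complex x (-R))" for x
  proof -
    have "((\<lambda>y. fs_theta' e p \<i> (of_real x + of_real y * \<i>)) has_integral
       fs_theta e p (of_real x + of_real R * \<i>) - fs_theta e p (of_real x + of_real (-R) * \<i>)) {-R..R}"
      by (intro fundamental_theorem_of_calculus has_vector_derivative_fs_theta e) (use R in simp)
    then show ?thesis by (simp add: X_def eq add.commute mult.commute integral_unique)
  qed
  have cI: "continuous_on X (\<lambda>x. integral X (\<lambda>y. fs_theta' e p h (Complex x y)))" for h
  proof -
    have "continuous_on (X \<times> cbox (-R) R) (\<lambda>z. fs_theta' e p h (Complex (fst z) (snd z)))"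
      by (intro c continuous_intros)
    then show ?thesis
      using integral_continuous_on_param[of X "-R" R "\<lambda>x y. fs_theta' e p h (Complex x y)"]
      by (simp add: X_def split_def)
  qed
  have "integral X (\<lambda>x. integral X (\<lambda>y. 2 * complex_of_real (fs_dens e p (Complex x y))))
     = integral X (\<lambda>x. integral X (\<lambda>y. fs_theta' e p 1 (Complex x y)) + \<i> * integral X (\<lambda>y. fs_theta' e p \<i> (Complex x y)))"
    unfolding fs_theta_dbar[OF e, symmetric]
    by (subst integral_add) (auto intro!: ii c continuous_intros e)
  also have "\<dots> = integral X (\<lambda>x. integral X (\<lambda>y. fs_theta' e p 1 (Complex x y)))
       + integral X (\<lambda>x. \<i> * integral X (\<lambda>y. fs_theta' e p \<i> (Complex x y)))"
    by (rule integral_add) (auto intro!: ii cI continuous_intros e)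
  also have "integral X (\<lambda>x. integral X (\<lambda>y. fs_theta' e p 1 (Complex x y)))
      = integral X (\<lambda>y. integral X (\<lambda>x. fs_theta' e p 1 (Complex x y)))"
  proof -
    have "continuous_on (cbox (-R, -R) (R, R)) (\<lambda>z. fs_theta' e p 1 (Complex (fst z) (snd z)))"
      by (intro c continuous_intros)
    then show ?thesis
      using integral_swap_continuous[of "-R" "-R" R R "\<lambda>x y. fs_theta' e p 1 (Complex x y)"]
      by (simp add: X_def split_def)
  qed
  also have "\<dots> + integral X (\<lambda>x. \<i> * integral X (\<lambda>y. fs_theta' e p \<i> (Complex x y)))
     = integral X (\<lambda>t. (fs_theta e p (Complex R t) - fs_theta e p (Complex (-R) t))
        + \<i> * (fs_theta e p (Complex t R) - fs_theta e p (Complex t (-R))))"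
    unfolding ftcx ftcy
    by (rule integral_add[symmetric]) (auto intro!: ii c0 continuous_intros e)
  finally show ?thesis .
qed

text \<open>Since ln (e + |p|^2) grows like 2 d ln |z|, its holomorphic derivative behaves like d /
  z. Numerator and denominator are divided by |z|^(2d), after which only the coefficients of degree
  d survive; d > 0 makes the contribution of e vanish.\<close>

lemma fs_theta_at_infinity:
  fixes p :: "'n::finite \<Rightarrow> complex poly"
  assumes e: "e > 0" and deg: "\<And>i. degree (p i) \<le> d" and k: "degree (p k) = d" and d: "d > 0"
  shows "((\<lambda>z. z * fs_theta e p z) \<longlongrightarrow> of_nat d) at_infinity"
proof -
  let ?c = "\<lambda>i. coeff (p i) d"
  let ?C = "\<Sum>i\<in>UNIV. ?c i * cnj (?c i)"
  have C: "?C \<noteq> 0"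
  proof -
    have "?c k \<noteq> 0" using k d by (metis degree_0 leading_coeff_0_iff less_numeral_extra(3))
    then have "(\<Sum>i\<in>UNIV. (cmod (?c i))\<^sup>2) > 0"
      by (intro sum_pos2[of _ k]) auto
    moreover have "?C = of_real (\<Sum>i\<in>UNIV. (cmod (?c i))\<^sup>2)"
      by (simp only: of_real_sum complex_norm_square)
    ultimately show ?thesis by (simp only: of_real_eq_0_iff)
  qed
  have a: "((\<lambda>z. poly (p i) z / z ^ d) \<longlongrightarrow> ?c i) at_infinity" for i
    by (rule tendsto_poly_div_power[OF deg])
  \<comment> \<open>The polynomial \<open>pCons 0 (pderiv (p i))\<close> is z p_i'(z): its degree
    stays at most d and its coefficient at d is d times that of p_i.\<close>
  have b: "((\<lambda>z. poly (pCons 0 (pderiv (p i))) z / z ^ d) \<longlongrightarrow> of_nat d * ?c i) at_infinity" for i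
  proof -
    have "degree (pCons 0 (pderiv (p i))) \<le> d"
      using deg[of i] d by (auto simp: degree_pCons_eq_if degree_pderiv)
    moreover have "coeff (pCons 0 (pderiv (p i))) d = of_nat d * ?c i"
      using d by (cases d) (auto simp: coeff_pderiv)
    ultimately show ?thesis using tendsto_poly_div_power by metis
  qed
  have inf: "((\<lambda>z::complex. of_real e / (z ^ d * cnj (z ^ d))) \<longlongrightarrow> 0) at_infinity"
  proof -
    have "((\<lambda>z::complex. 1 / z ^ d) \<longlongrightarrow> 0) at_infinity"
      using tendsto_poly_div_power[of "1 :: complex poly" d] d by (simp add: one_poly_eq_simps coeff_eq_0)
    from tendsto_mult[OF tendsto_mult[OF this tendsto_cnj[OF this]] tendsto_const[of "of_real e"]]
    show ?thesis by (simp add: field_simps)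
  qed
  have "((\<lambda>z. (\<Sum>i\<in>UNIV. poly (pCons 0 (pderiv (p i))) z / z ^ d * cnj (poly (p i) z / z ^ d))
       / (of_real e / (z ^ d * cnj (z ^ d)) + (\<Sum>i\<in>UNIV. poly (p i) z / z ^ d * cnj (poly (p i) z / z ^ d))))
     \<longlongrightarrow> (\<Sum>i\<in>UNIV. of_nat d * ?c i * cnj (?c i)) / (0 + ?C)) at_infinity"
    using C by (intro tendsto_divide tendsto_add tendsto_sum tendsto_mult tendsto_cnj a b inf) auto
  also have "(\<Sum>i\<in>UNIV. of_nat d * ?c i * cnj (?c i)) / (0 + ?C) = of_nat d"
    using C by (simp add: sum_distrib_left[symmetric] mult.assoc)
  finally show ?thesis
  proof (rule Lim_transform_eventually)
    show "\<forall>\<^sub>F z in at_infinity. (\<Sum>i\<in>UNIV. poly (pCons 0 (pderiv (p i))) z / z ^ d * cnj (poly (p i) z / z ^ d))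
       / (of_real e / (z ^ d * cnj (z ^ d)) + (\<Sum>i\<in>UNIV. poly (p i) z / z ^ d * cnj (poly (p i) z / z ^ d)))
      = z * fs_theta e p z"
      unfolding eventually_at_infinity
    proof (intro exI[of _ 1] allI impI)
      fix z :: complex assume "1 \<le> norm z"
      then have z: "z ^ d * cnj (z ^ d) \<noteq> 0" by auto
      have 1: "(\<Sum>i\<in>UNIV. poly (pCons 0 (pderiv (p i))) z / z ^ d * cnj (poly (p i) z / z ^ d))
          = z * fs_num p z / (z ^ d * cnj (z ^ d))"
        by (simp add: fs_num_def sum_divide_distrib sum_distrib_left mult_ac)
      have 2: "of_real e / (z ^ d * cnj (z ^ d)) + (\<Sum>i\<in>UNIV. poly (p i) z / z ^ d * cnj (poly (p i) z / z ^ d))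
          = of_real (fs_den e p z) / (z ^ d * cnj (z ^ d))"
        by (simp add: fs_den_complex sum_divide_distrib add_divide_distrib)
      show "(\<Sum>i\<in>UNIV. poly (pCons 0 (pderiv (p i))) z / z ^ d * cnj (poly (p i) z / z ^ d))
       / (of_real e / (z ^ d * cnj (z ^ d)) + (\<Sum>i\<in>UNIV. poly (p i) z / z ^ d * cnj (poly (p i) z / z ^ d)))
      = z * fs_theta e p z"
        unfolding 1 2 fs_theta_def using z by simp
    qed
  qed
qed


text \<open>The comparison function d / z has flux 2 pi d. On the boundary the deviation from it is
  at most \<open>\<delta>\<close> / R, and the four sides have total length 8 R.\<close>

lemma fs_theta_flux_bound:
  fixes R d \<delta> :: real
  assumes R: "R > 0" and e: "e > 0" and \<delta>: "\<And>z. cmod z \<ge> R \<Longrightarrow> cmod (z * fs_theta e p z - of_real d) \<le> \<delta>"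
  shows "cmod (integral {-R..R} (\<lambda>t. (fs_theta e p (Complex R t) - fs_theta e p (Complex (-R) t))
        + \<i> * (fs_theta e p (Complex t R) - fs_theta e p (Complex t (-R)))) - of_real (2 * pi * d)) \<le> 8 * \<delta>"
proof -
  let ?F = "\<lambda>t. (fs_theta e p (Complex R t) - fs_theta e p (Complex (-R) t))
        + \<i> * (fs_theta e p (Complex t R) - fs_theta e p (Complex t (-R)))"
  have c0: "continuous_on S (\<lambda>x. fs_theta e p (Complex (f x) (g x)))"
    if "continuous_on S f" "continuous_on S g" for S :: "real set" and f g
    unfolding Complex_eq using e that by (auto intro!: continuous_intros)
  have F: "(?F has_integral integral {-R..R} ?F) {-R..R}"
    by (intro integrable_integral integrable_continuous_interval) (auto intro!: continuous_intros c0)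
  \<comment> \<open>The values of d / z at the four boundary points with parameter t combine to 4 d
    R / (R^2 + t^2), whose primitive is an arctangent; the angle from -pi/4 to pi/4, taken four
    times, gives 2 pi.\<close>
  have "((\<lambda>t. d * (4 * R / (R\<^sup>2 + t\<^sup>2))) has_integral (d * (4 * arctan (R / R)) - d * (4 * arctan ((-R) / R)))) {-R..R}"
  proof (rule fundamental_theorem_of_calculus)
    fix t
    have pos: "R\<^sup>2 + t\<^sup>2 > 0" using R by (simp add: add_pos_nonneg)
    have "((\<lambda>t. d * (4 * arctan (t / R))) has_real_derivative d * (4 * R / (R\<^sup>2 + t\<^sup>2))) (at t within {-R..R})"
      using R pos by (auto intro!: derivative_eq_intros simp: field_simps power2_eq_square)
    then show "((\<lambda>t. d * (4 * arctan (t / R))) has_vector_derivative d * (4 * R / (R\<^sup>2 + t\<^sup>2))) (at t within {-R..R})"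
      by (simp add: has_real_derivative_iff_has_vector_derivative)
  qed (use R in simp)
  then have "((\<lambda>t. d * (4 * R / (R\<^sup>2 + t\<^sup>2))) has_integral 2 * pi * d) {-R..R}"
    using R by (simp add: arctan_minus arctan_one mult.assoc)
  then have A: "((\<lambda>t. complex_of_real (d * (4 * R / (R\<^sup>2 + t\<^sup>2)))) has_integral of_real (2 * pi * d)) {-R..R}"
    by (rule has_integral_of_real)
  have \<theta>: "\<exists>w. fs_theta e p z = of_real d / z + w \<and> cmod w \<le> \<delta> / R" if "cmod z \<ge> R" for z
  proof (intro exI conjI)
    have z: "z \<noteq> 0" using that R by auto
    show "fs_theta e p z = of_real d / z + (z * fs_theta e p z - of_real d) / z"
      using z by (simp add: diff_divide_distrib)
    have "cmod ((z * fs_theta e p z - of_real d) / z) \<le> \<delta> / cmod z"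
      using \<delta>[OF that] by (simp add: norm_divide divide_right_mono)
    also have "\<dots> \<le> \<delta> / R"
      using that R order_trans[OF norm_ge_zero \<delta>[OF that]]
      by (intro divide_left_mono) (auto intro!: mult_pos_pos)
    finally show "cmod ((z * fs_theta e p z - of_real d) / z) \<le> \<delta> / R" .
  qed
  have "cmod (?F t - of_real (d * (4 * R / (R\<^sup>2 + t\<^sup>2)))) \<le> 4 * (\<delta> / R)" for t
  proof -
    have ge: "cmod (Complex R t) \<ge> R" "cmod (Complex (-R) t) \<ge> R" "cmod (Complex t R) \<ge> R" "cmod (Complex t (-R)) \<ge> R"
      using R by (simp_all add: cmod_def real_le_rsqrt)
    obtain w1 where w1: "fs_theta e p (Complex R t) = of_real d / Complex R t + w1" "cmod w1 \<le> \<delta> / R" using \<theta>[OF ge(1)] by blast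
    obtain w2 where w2: "fs_theta e p (Complex (-R) t) = of_real d / Complex (-R) t + w2" "cmod w2 \<le> \<delta> / R" using \<theta>[OF ge(2)] by blast
    obtain w3 where w3: "fs_theta e p (Complex t R) = of_real d / Complex t R + w3" "cmod w3 \<le> \<delta> / R" using \<theta>[OF ge(3)] by blast
    obtain w4 where w4: "fs_theta e p (Complex t (-R)) = of_real d / Complex t (-R) + w4" "cmod w4 \<le> \<delta> / R" using \<theta>[OF ge(4)] by blast
    have pos: "R\<^sup>2 + t\<^sup>2 > 0" using R by (simp add: add_pos_nonneg)
    have main: "(of_real d / Complex R t - of_real d / Complex (-R) t)
        + \<i> * (of_real d / Complex t R - of_real d / Complex t (-R)) = of_real (d * (4 * R / (R\<^sup>2 + t\<^sup>2)))"
    proof -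
      define q where "q = R\<^sup>2 + t\<^sup>2"
      have q: "q \<noteq> 0" "t\<^sup>2 + R\<^sup>2 = q" "R\<^sup>2 + t\<^sup>2 = q" using pos by (auto simp: q_def)
      show ?thesis
        by (simp add: complex_eq_iff Re_divide Im_divide q(2,3)) (simp add: q(1) field_simps power2_eq_square)
    qed
    have "?F t - of_real (d * (4 * R / (R\<^sup>2 + t\<^sup>2))) = (w1 - w2) + \<i> * (w3 - w4)"
      unfolding w1(1) w2(1) w3(1) w4(1) main[symmetric] by (simp add: algebra_simps)
    also have "cmod \<dots> \<le> (cmod w1 + cmod w2) + (cmod w3 + cmod w4)"
      by (rule order_trans[OF norm_triangle_ineq])
         (intro add_mono norm_triangle_ineq4, simp add: norm_mult norm_triangle_ineq4)
    also have "\<dots> \<le> 4 * (\<delta> / R)" using w1 w2 w3 w4 by simp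
    finally show ?thesis .
  qed
  moreover have "\<delta> \<ge> 0"
    using order_trans[OF norm_ge_zero \<delta>[of "of_real R"]] R by simp
  ultimately have "cmod (integral {-R..R} ?F - of_real (2 * pi * d)) \<le> 4 * (\<delta> / R) * (2 * R)"
    using has_integral_bound_real[OF _ finite.emptyI has_integral_diff[OF F A], of "4 * (\<delta> / R)"] R by simp
  then show ?thesis using R by simp
qed

lemma fs_area_square:
  fixes R :: real
  assumes e: "e > 0" and R: "R > 0"
  defines "X \<equiv> {-R..R}"
  shows "(\<integral>\<^sup>+z. indicator {z. Re z \<in> X \<and> Im z \<in> X} z * ennreal (fs_dens e p z) \<partial>lborel)
    = ennreal (integral X (\<lambda>x. integral X (\<lambda>y. fs_dens e p (Complex x y))))"
proof -
  have c: "continuous_on S (\<lambda>x. fs_dens e p (Complex (f x) (g x)))"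
    if "continuous_on S f" "continuous_on S g" for S :: "'c::topological_space set" and f g
    unfolding Complex_eq using e that by (auto intro!: continuous_intros)
  have [measurable]: "fs_dens e p \<in> borel_measurable borel"
    using e by (intro borel_measurable_continuous_onI continuous_intros)
  have [measurable]: "{z. Re z \<in> X \<and> Im z \<in> X} \<in> sets borel"
  proof -
    have "{z. Re z \<in> X \<and> Im z \<in> X} = cbox (Complex (-R) (-R)) (Complex R R)"
      by (auto simp: X_def in_cbox_complex_iff)
    then show ?thesis by simp
  qed
  have inner: "(\<integral>\<^sup>+y. indicator X y * ennreal (fs_dens e p (Complex x y)) \<partial>lborel)
      = ennreal (integral X (\<lambda>y. fs_dens e p (Complex x y)))" for x
  proof -
    have "((\<lambda>y. fs_dens e p (Complex x y)) has_integral integral X (\<lambda>y. fs_dens e p (Complex x y))) X"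
      unfolding X_def by (intro integrable_integral integrable_continuous_interval c continuous_intros)
    from nn_integral_has_integral_lebesgue[OF _ this] fs_dens_nonneg[OF e, of p] show ?thesis
      by (simp add: ennreal_mult' ennreal_indicator)
  qed
  have cI: "continuous_on X (\<lambda>x. integral X (\<lambda>y. fs_dens e p (Complex x y)))"
  proof -
    have "continuous_on (X \<times> cbox (-R) R) (\<lambda>z. fs_dens e p (Complex (fst z) (snd z)))"
      by (intro c continuous_intros)
    then show ?thesis
      using integral_continuous_on_param[of X "-R" R "\<lambda>x y. fs_dens e p (Complex x y)"]
      by (simp add: X_def split_def)
  qed
  have "(\<integral>\<^sup>+z. indicator {z. Re z \<in> X \<and> Im z \<in> X} z * ennreal (fs_dens e p z) \<partial>lborel)
     = (\<integral>\<^sup>+x. \<integral>\<^sup>+y. indicator X x * (indicator X y * ennreal (fs_dens e p (Complex x y))) \<partial>lborel \<partial>lborel)"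
  proof -
    have "(\<lambda>z. indicator {z. Re z \<in> X \<and> Im z \<in> X} z * ennreal (fs_dens e p z)) \<in> borel_measurable borel"
      by measurable
    from nn_integral_lborel_complex[OF this] show ?thesis
      by (auto intro!: nn_integral_cong simp: indicator_def)
  qed
  also have "\<dots> = (\<integral>\<^sup>+x. indicator X x * ennreal (integral X (\<lambda>y. fs_dens e p (Complex x y))) \<partial>lborel)"
  proof (rule nn_integral_cong)
    fix x :: real
    show "(\<integral>\<^sup>+y. indicator X x * (indicator X y * ennreal (fs_dens e p (Complex x y))) \<partial>lborel)
      = indicator X x * ennreal (integral X (\<lambda>y. fs_dens e p (Complex x y)))"
      using inner[of x] by (auto simp: indicator_def)
  qed
  also have "\<dots> = ennreal (integral X (\<lambda>x. integral X (\<lambda>y. fs_dens e p (Complex x y))))"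
  proof -
    have "((\<lambda>x. integral X (\<lambda>y. fs_dens e p (Complex x y))) has_integral
        integral X (\<lambda>x. integral X (\<lambda>y. fs_dens e p (Complex x y)))) X"
      using cI unfolding X_def by (intro integrable_integral integrable_continuous_interval)
    moreover have "integral X (\<lambda>y. fs_dens e p (Complex x y)) \<ge> 0" for x
      using fs_dens_nonneg[OF e] unfolding X_def
      by (intro integral_nonneg integrable_continuous_interval c continuous_intros)
    ultimately show ?thesis
      using nn_integral_has_integral_lebesgue[of X "\<lambda>x. integral X (\<lambda>y. fs_dens e p (Complex x y))"]
      by (simp add: ennreal_mult' ennreal_indicator)
  qed
  finally show ?thesis .
qed

text \<open>With d the largest degree, the area inside growing squares approaches pi d, half the
  limiting flux 2 pi d. The bound depends neither on e nor on the coefficients.\<close>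

lemma fs_area_le:
  fixes p :: "'n::finite \<Rightarrow> complex poly"
  assumes e: "e > 0" and deg: "\<And>i. degree (p i) \<le> N"
  shows "(\<integral>\<^sup>+z. ennreal (fs_dens e p z) \<partial>lborel) \<le> ennreal (pi * N)"
proof -
  define d where "d = Max (range (\<lambda>i. degree (p i)))"
  have dmax: "degree (p i) \<le> d" for i unfolding d_def by simp
  have "d \<in> range (\<lambda>i. degree (p i))" unfolding d_def by (intro Max_in) auto
  then obtain k where k: "degree (p k) = d" by auto
  have dN: "d \<le> N" using deg[of k] k by simp
  show ?thesis
  \<comment> \<open>A constant curve has density 0; it is treated apart because the asymptotics at
    infinity require d > 0.\<close>
  proof (cases "d = 0")
    case True
    then have "pderiv (p i) = 0" for i using dmax[of i] by (simp add: pderiv_eq_0_iff)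
    then have "fs_dens e p z = 0" for z by (simp add: fs_dens_def fs_num_def)
    then show ?thesis by simp
  next
    case False
    have [measurable]: "fs_dens e p \<in> borel_measurable borel"
      using e by (intro borel_measurable_continuous_onI continuous_intros)
    show ?thesis
    proof (rule ennreal_le_epsilon)
      fix \<epsilon> :: real assume \<epsilon>: "\<epsilon> > 0"
      \<comment> \<open>The flux error 8 \<open>\<delta>\<close> concerns twice the area, so this
        choice leaves exactly the error \<open>\<epsilon>\<close>.\<close>
      define \<delta> where "\<delta> = \<epsilon> / 4"
      have "\<delta> > 0" using \<epsilon> by (simp add: \<delta>_def)
      from tendstoD[OF fs_theta_at_infinity[where p=p and d=d and k=k, OF e dmax k] this] False
      have "\<forall>\<^sub>F z in at_infinity. dist (z * fs_theta e p z) (of_nat d) < \<delta>" by blast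
      then obtain b where b: "\<And>z. cmod z \<ge> b \<Longrightarrow> dist (z * fs_theta e p z) (of_nat d) < \<delta>"
        by (auto simp: eventually_at_infinity)
      let ?Q = "\<lambda>R. {z. Re z \<in> {-R..R} \<and> Im z \<in> {-R..R}}"
      have big: "(\<integral>\<^sup>+z. indicator (?Q R) z * ennreal (fs_dens e p z) \<partial>lborel) \<le> ennreal (pi * N + \<epsilon>)"
        if R: "R > 0" "R \<ge> b" for R
      proof -
        let ?I = "integral {-R..R} (\<lambda>x. integral {-R..R} (\<lambda>y. fs_dens e p (Complex x y)))"
        have "of_real (2 * ?I) = integral {-R..R} (\<lambda>x. integral {-R..R} (\<lambda>y. 2 * complex_of_real (fs_dens e p (Complex x y))))"
        proof -
          have c: "continuous_on S (\<lambda>x. fs_dens e p (Complex (f x) (g x)))"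
            if "continuous_on S f" "continuous_on S g" for S :: "'c::topological_space set" and f g
            unfolding Complex_eq using e that by (auto intro!: continuous_intros)
          have "continuous_on ({-R..R} \<times> cbox (-R) R) (\<lambda>z. fs_dens e p (Complex (fst z) (snd z)))"
            by (intro c continuous_intros)
          then have "continuous_on {-R..R} (\<lambda>x. integral {-R..R} (\<lambda>y. fs_dens e p (Complex x y)))"
            using integral_continuous_on_param[of "{-R..R}" "-R" R "\<lambda>x y. fs_dens e p (Complex x y)"]
            by (simp add: split_def)
          then have i2: "(\<lambda>x. integral {-R..R} (\<lambda>y. fs_dens e p (Complex x y))) integrable_on {-R..R}"
            by (rule integrable_continuous_interval)
          have i1: "(\<lambda>y. fs_dens e p (Complex x y)) integrable_on {-R..R}" for x
            by (intro integrable_continuous_interval c continuous_intros)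
          have of_real_int: "integral {-R..R} (\<lambda>t. complex_of_real (f t)) = of_real (integral {-R..R} f)"
            if "f integrable_on {-R..R}" for f
            using integral_linear[OF that bounded_linear_of_real] by (simp add: o_def)
          show ?thesis
            by (simp add: of_real_int i1 i2)
        qed
        moreover have "cmod (integral {-R..R} (\<lambda>x. integral {-R..R} (\<lambda>y. 2 * complex_of_real (fs_dens e p (Complex x y))))
             - of_real (2 * pi * real d)) \<le> 8 * \<delta>"
          unfolding fs_theta_square_identity[OF e R(1)]
          by (rule fs_theta_flux_bound[OF R(1) e]) (use b R in \<open>force simp: dist_norm intro: less_imp_le\<close>)
        ultimately have "cmod (of_real (2 * ?I) - of_real (2 * pi * real d)) \<le> 8 * \<delta>" by simp
        then have "\<bar>2 * ?I - 2 * pi * real d\<bar> \<le> 8 * \<delta>"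
          unfolding of_real_diff[symmetric] norm_of_real .
        then have "?I \<le> pi * real d + \<epsilon>" by (simp add: \<delta>_def)
        also have "\<dots> \<le> pi * N + \<epsilon>" using dN by simp
        finally show ?thesis
          by (simp only: fs_area_square[OF e R(1)] ennreal_leI)
      qed
      have "(\<integral>\<^sup>+z. ennreal (fs_dens e p z) \<partial>lborel)
        = (\<integral>\<^sup>+z. (SUP m. indicator (?Q (real m)) z * ennreal (fs_dens e p z)) \<partial>lborel)"
      proof (rule nn_integral_cong)
        fix z
        obtain m :: nat where m: "max \<bar>Re z\<bar> \<bar>Im z\<bar> \<le> real m" using real_arch_simple by blast
        show "ennreal (fs_dens e p z) = (SUP m. indicator (?Q (real m)) z * ennreal (fs_dens e p z))"
        proof (rule antisym)
          show "ennreal (fs_dens e p z) \<le> (SUP m. indicator (?Q (real m)) z * ennreal (fs_dens e p z))"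
            using m by (intro SUP_upper2[of m]) (auto simp: indicator_def)
        qed (auto intro!: SUP_least simp: indicator_def)
      qed
      also have "\<dots> = (SUP m. \<integral>\<^sup>+z. indicator (?Q (real m)) z * ennreal (fs_dens e p z) \<partial>lborel)"
      proof (rule nn_integral_monotone_convergence_SUP)
        show "incseq (\<lambda>m z. indicator (?Q (real m)) z * ennreal (fs_dens e p z))"
          by (auto simp: incseq_def le_fun_def indicator_def)
        fix m
        have "?Q (real m) = cbox (Complex (-real m) (-real m)) (Complex m m)"
          by (auto simp: in_cbox_complex_iff)
        then have [measurable]: "?Q (real m) \<in> sets borel" by simp
        show "(\<lambda>z. indicator (?Q (real m)) z * ennreal (fs_dens e p z)) \<in> borel_measurable lborel"
          by measurable
      qed
      also have "\<dots> \<le> ennreal (pi * N + \<epsilon>)"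
      proof (rule SUP_least)
        fix m
        \<comment> \<open>The flux estimate is available only beyond radius b, so a small square is
          first enlarged.\<close>
        define R where "R = max (real m) (max b 1)"
        have R: "R > 0" "R \<ge> b" "real m \<le> R" by (auto simp: R_def)
        have "(\<integral>\<^sup>+z. indicator (?Q (real m)) z * ennreal (fs_dens e p z) \<partial>lborel)
          \<le> (\<integral>\<^sup>+z. indicator (?Q R) z * ennreal (fs_dens e p z) \<partial>lborel)"
          using R(3) by (intro nn_integral_mono) (auto simp: indicator_def)
        also have "\<dots> \<le> ennreal (pi * N + \<epsilon>)" by (rule big[OF R(1,2)])
        finally show "(\<integral>\<^sup>+z. indicator (?Q (real m)) z * ennreal (fs_dens e p z) \<partial>lborel) \<le> ennreal (pi * N + \<epsilon>)" .
      qed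
      also have "\<dots> = ennreal (pi * N) + ennreal \<epsilon>" using \<epsilon> by (simp add: ennreal_plus)
      finally show "(\<integral>\<^sup>+z. ennreal (fs_dens e p z) \<partial>lborel) \<le> ennreal (pi * N) + ennreal \<epsilon>" .
    qed
  qed
qed

section \<open>Sums over simple roots\<close>

lemma finite_set_separated:
  fixes Z :: "'a::metric_space set"
  assumes "finite Z"
  obtains r where "r > 0" "\<And>a b. a \<in> Z \<Longrightarrow> b \<in> Z \<Longrightarrow> a \<noteq> b \<Longrightarrow> ball a r \<inter> ball b r = {}"
proof -
  define D where "D = insert 1 ((\<lambda>(a, b). dist a b) ` {(a, b) \<in> Z \<times> Z. a \<noteq> b})"
  have fin: "finite D"
    unfolding D_def by (intro finite.insertI finite_imageI finite_subset[OF _ finite_cartesian_product[OF assms assms]]) auto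
  have pos: "Min D > 0" using fin by (subst Min_gr_iff) (auto simp: D_def)
  show ?thesis
  proof
    show "Min D / 2 > 0" using pos by simp
    fix a b assume ab: "a \<in> Z" "b \<in> Z" "a \<noteq> b"
    have "Min D \<le> dist a b" using fin by (rule Min_le) (use ab in \<open>auto simp: D_def\<close>)
    then show "ball a (Min D / 2) \<inter> ball b (Min D / 2) = {}"
      by (intro disjoint_ballI) simp
  qed
qed

lemma nn_integral_lborel_scale_complex:
  fixes f :: "complex \<Rightarrow> ennreal" and \<epsilon> :: real
  assumes [measurable]: "f \<in> borel_measurable borel" and \<epsilon>: "\<epsilon> > 0"
  shows "(\<integral>\<^sup>+z. f z \<partial>lborel) = (\<integral>\<^sup>+x. ennreal (\<epsilon>\<^sup>2) * f (a + of_real \<epsilon> * x) \<partial>lborel)"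
proof -
  have "(\<integral>\<^sup>+z. f z \<partial>lborel) = (\<integral>\<^sup>+z. f z \<partial>density (distr lborel borel (\<lambda>x. a + \<epsilon> *\<^sub>R x)) (\<lambda>_. ennreal (\<bar>\<epsilon>\<bar> ^ DIM(complex))))"
    using lborel_affine[of \<epsilon> a] \<epsilon> by simp
  also have "\<dots> = (\<integral>\<^sup>+x. ennreal (\<epsilon>\<^sup>2) * f (a + of_real \<epsilon> * x) \<partial>lborel)"
    using \<epsilon> by (subst nn_integral_density) (simp_all add: nn_integral_distr scaleR_conv_of_real)
  finally show ?thesis .
qed

lemma gdens_scale: 
  fixes w :: complex
  assumes "\<epsilon> > 0" shows "\<epsilon>\<^sup>2 * gdens (\<epsilon>\<^sup>2) w = gdens 1 (w / of_real \<epsilon>)"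
  using assms by (simp add: gdens_complex norm_divide power_divide)

text \<open>Multiplication by c has real Jacobian |c|^2. With c = p'(a) this is the origin of the
  weight 1 / |p'(a)|^2 at a root.\<close>

lemma gdens_total_linear:
  fixes c :: complex
  assumes "c \<noteq> 0"
  shows "(\<integral>\<^sup>+x. ennreal (gdens 1 (c * x)) \<partial>lborel) = ennreal (1 / (cmod c)\<^sup>2)"
proof -
  have "gdens 1 (c * x) = 1 / (cmod c)\<^sup>2 * gdens (1 / (cmod c)\<^sup>2) x" for x :: complex
    using assms by (simp add: gdens_complex norm_mult power_mult_distrib mult.commute)
  then have "(\<integral>\<^sup>+x. ennreal (gdens 1 (c * x)) \<partial>lborel)
      = (\<integral>\<^sup>+x. ennreal (1 / (cmod c)\<^sup>2) * ennreal (gdens (1 / (cmod c)\<^sup>2) (x :: complex)) \<partial>lborel)"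
    by (simp only: ennreal_mult'[symmetric] zero_le_divide_iff zero_le_power2 zero_le_one simp_thms)
  then show ?thesis
    using gdens_total[of "1 / (cmod c)\<^sup>2", where 'a=complex] assms
    by (simp add: nn_integral_cmult)
qed

text \<open>Near a simple root a, substitute z = a + eps x: p(a + eps x) / eps tends to p'(a) x, and
  the Jacobian eps^2 cancels against the height of the kernel of variance eps^2. The rescaled
  integrands converge pointwise, and Fatou's lemma turns this into the stated inequality.\<close>

lemma simple_roots_kernel_liminf:
  fixes p :: "complex \<Rightarrow> complex" and G :: "complex \<Rightarrow> real"
  assumes fin: "finite Z" and G0: "\<And>z. G z \<ge> 0"
    and root: "\<And>a. a \<in> Z \<Longrightarrow> p a = 0"
    and deriv: "\<And>a. a \<in> Z \<Longrightarrow> (p has_field_derivative p' a) (at a)"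
    and simple: "\<And>a. a \<in> Z \<Longrightarrow> p' a \<noteq> 0"
    and cont: "\<And>a. a \<in> Z \<Longrightarrow> isCont G a"
    and [measurable]: "p \<in> borel_measurable borel" "G \<in> borel_measurable borel"
  shows "(\<Sum>a\<in>Z. ennreal (G a / (cmod (p' a))\<^sup>2))
    \<le> liminf (\<lambda>i. \<integral>\<^sup>+z. ennreal (G z * gdens ((inverse (real (Suc i)))\<^sup>2) (p z)) \<partial>lborel)"
proof -
  obtain r where r: "r > 0" "\<And>a b. a \<in> Z \<Longrightarrow> b \<in> Z \<Longrightarrow> a \<noteq> b \<Longrightarrow> ball a r \<inter> ball b r = {}"
    using finite_set_separated[OF fin] by blast
  define \<epsilon> where "\<epsilon> i = inverse (real (Suc i))" for i
  have \<epsilon>: "\<epsilon> i > 0" for i by (simp add: \<epsilon>_def)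
  have \<epsilon>0: "\<epsilon> \<longlonglongrightarrow> 0" unfolding \<epsilon>_def[abs_def] by (rule LIMSEQ_inverse_real_of_nat)
  \<comment> \<open>The integrand seen at scale eps around a. The indicator keeps the neighbourhoods
    of distinct roots disjoint, so that the pieces can be added up again below the full
    integral.\<close>
  define f where "f i a x = indicat_real (ball a r) (a + of_real (\<epsilon> i) * x) * G (a + of_real (\<epsilon> i) * x)
      * gdens 1 (p (a + of_real (\<epsilon> i) * x) / of_real (\<epsilon> i))" for i a x
  have f0: "f i a x \<ge> 0" for i a x by (simp add: f_def G0)
  have [measurable]: "ball a r \<in> sets borel" for a by simp
  have [measurable]: "f i a \<in> borel_measurable borel" for i a
  proof -
    have "(\<lambda>x. a + of_real (\<epsilon> i) * x) \<in> borel \<rightarrow>\<^sub>M (borel :: complex measure)"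
      by (intro borel_measurable_continuous_onI continuous_intros)
    moreover have "(\<lambda>z. indicat_real (ball a r) z * G z * gdens 1 (p z / of_real (\<epsilon> i))) \<in> borel_measurable borel"
      by measurable
    ultimately show ?thesis unfolding f_def[abs_def] by (rule measurable_compose)
  qed
  have lim: "(\<lambda>i. f i a x) \<longlonglongrightarrow> 1 * G a * gdens 1 (p' a * x)" if a: "a \<in> Z" for a x
  proof -
    have z0: "(\<lambda>i. of_real (\<epsilon> i) :: complex) \<longlonglongrightarrow> 0"
      using tendsto_of_real[OF \<epsilon>0, where 'a=complex] by simp
    have z: "(\<lambda>i. a + of_real (\<epsilon> i) * x) \<longlonglongrightarrow> a"
      using tendsto_add[OF tendsto_const[of a] tendsto_mult[OF z0 tendsto_const[of x]]] by simp
    have "\<forall>\<^sub>F i in sequentially. a + of_real (\<epsilon> i) * x \<in> ball a r"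
      using z r(1) by (intro topological_tendstoD) auto
    then have 1: "(\<lambda>i. indicat_real (ball a r) (a + of_real (\<epsilon> i) * x)) \<longlonglongrightarrow> 1"
      by (intro tendsto_eventually) (auto elim!: eventually_mono)
    have 2: "(\<lambda>i. G (a + of_real (\<epsilon> i) * x)) \<longlonglongrightarrow> G a"
      by (rule isCont_tendsto_compose[OF cont[OF a] z])
    have "((\<lambda>h. p (a + h * x)) has_field_derivative p' a * x) (at 0)"
      using deriv[OF a] by (intro DERIV_chain2[where g="\<lambda>h. a + h * x"]) (auto intro!: derivative_eq_intros)
    then have "(\<lambda>h. (p (a + h * x) - p a) / h) \<midarrow>0\<rightarrow> p' a * x"
      by (simp add: DERIV_def)
    moreover have "filterlim (\<lambda>i. of_real (\<epsilon> i) :: complex) (at 0) sequentially"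
      using z0 \<epsilon> by (simp add: filterlim_at less_imp_neq[symmetric])
    ultimately have "(\<lambda>i. (p (a + of_real (\<epsilon> i) * x) - p a) / of_real (\<epsilon> i)) \<longlonglongrightarrow> p' a * x"
      by (rule filterlim_compose)
    then have 3: "(\<lambda>i. p (a + of_real (\<epsilon> i) * x) / of_real (\<epsilon> i)) \<longlonglongrightarrow> p' a * x"
      by (simp add: root[OF a])
    have "(\<lambda>i. gdens 1 (p (a + of_real (\<epsilon> i) * x) / of_real (\<epsilon> i))) \<longlonglongrightarrow> gdens 1 (p' a * x)"
      unfolding gdens_def by (intro tendsto_intros 3) auto
    with 1 2 show ?thesis unfolding f_def by (intro tendsto_mult)
  qed
  have "(\<Sum>a\<in>Z. ennreal (G a / (cmod (p' a))\<^sup>2))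
      = (\<Sum>a\<in>Z. \<integral>\<^sup>+x. ennreal (G a * gdens 1 (p' a * x)) \<partial>lborel)"
  proof (rule sum.cong)
    fix a assume a: "a \<in> Z"
    have "(\<integral>\<^sup>+x. ennreal (G a * gdens 1 (p' a * x)) \<partial>lborel)
        = (\<integral>\<^sup>+x. ennreal (G a) * ennreal (gdens 1 (p' a * x)) \<partial>lborel)"
      by (simp only: ennreal_mult G0 gdens_nonneg)
    also have "\<dots> = ennreal (G a) * ennreal (1 / (cmod (p' a))\<^sup>2)"
      by (simp add: nn_integral_cmult gdens_total_linear[OF simple[OF a]])
    also have "\<dots> = ennreal (G a / (cmod (p' a))\<^sup>2)"
      by (subst ennreal_mult[symmetric]) (simp_all add: G0)
    finally show "ennreal (G a / (cmod (p' a))\<^sup>2) = (\<integral>\<^sup>+x. ennreal (G a * gdens 1 (p' a * x)) \<partial>lborel)" ..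
  qed simp
  also have "\<dots> = (\<integral>\<^sup>+x. (\<Sum>a\<in>Z. ennreal (G a * gdens 1 (p' a * x))) \<partial>lborel)"
    by (rule nn_integral_sum[symmetric]) simp
  also have "\<dots> = (\<integral>\<^sup>+x. liminf (\<lambda>i. \<Sum>a\<in>Z. ennreal (f i a x)) \<partial>lborel)"
  proof (rule nn_integral_cong)
    fix x
    have "(\<lambda>i. \<Sum>a\<in>Z. ennreal (f i a x)) \<longlonglongrightarrow> (\<Sum>a\<in>Z. ennreal (G a * gdens 1 (p' a * x)))"
      using lim by (intro tendsto_sum tendsto_ennrealI) simp
    then show "(\<Sum>a\<in>Z. ennreal (G a * gdens 1 (p' a * x))) = liminf (\<lambda>i. \<Sum>a\<in>Z. ennreal (f i a x))"
      by (simp add: lim_imp_Liminf)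
  qed
  also have "\<dots> \<le> liminf (\<lambda>i. \<integral>\<^sup>+x. (\<Sum>a\<in>Z. ennreal (f i a x)) \<partial>lborel)"
    by (rule nn_integral_liminf) simp
  also have "\<dots> \<le> liminf (\<lambda>i. \<integral>\<^sup>+z. ennreal (G z * gdens ((\<epsilon> i)\<^sup>2) (p z)) \<partial>lborel)"
  proof (rule Liminf_mono, rule always_eventually, rule allI)
    fix i
    let ?h = "\<lambda>z. G z * gdens ((\<epsilon> i)\<^sup>2) (p z)"
    have "(\<integral>\<^sup>+x. (\<Sum>a\<in>Z. ennreal (f i a x)) \<partial>lborel) = (\<Sum>a\<in>Z. \<integral>\<^sup>+x. ennreal (f i a x) \<partial>lborel)"
      by (rule nn_integral_sum) simp
    also have "\<dots> = (\<Sum>a\<in>Z. \<integral>\<^sup>+z. ennreal (indicat_real (ball a r) z * ?h z) \<partial>lborel)"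
    proof (rule sum.cong)
      fix a assume "a \<in> Z"
      have "(\<integral>\<^sup>+z. ennreal (indicat_real (ball a r) z * ?h z) \<partial>lborel)
         = (\<integral>\<^sup>+x. ennreal ((\<epsilon> i)\<^sup>2) * ennreal (indicat_real (ball a r) (a + of_real (\<epsilon> i) * x) * ?h (a + of_real (\<epsilon> i) * x)) \<partial>lborel)"
        by (rule nn_integral_lborel_scale_complex) (measurable, rule \<epsilon>)
      also have "\<dots> = (\<integral>\<^sup>+x. ennreal (f i a x) \<partial>lborel)"
        by (rule nn_integral_cong)
           (simp add: f_def gdens_scale[OF \<epsilon>, symmetric] ennreal_mult'[symmetric] mult_ac)
      finally show "(\<integral>\<^sup>+x. ennreal (f i a x) \<partial>lborel) = (\<integral>\<^sup>+z. ennreal (indicat_real (ball a r) z * ?h z) \<partial>lborel)" ..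
    qed simp
    also have "\<dots> = (\<integral>\<^sup>+z. (\<Sum>a\<in>Z. ennreal (indicat_real (ball a r) z * ?h z)) \<partial>lborel)"
      by (rule nn_integral_sum[symmetric]) simp
    also have "\<dots> \<le> (\<integral>\<^sup>+z. ennreal (?h z) \<partial>lborel)"
    proof (rule nn_integral_mono)
      fix z
      have "(\<Sum>a\<in>Z. indicat_real (ball a r) z) \<le> 1"
      proof (cases "\<exists>a\<in>Z. z \<in> ball a r")
        case True
        then obtain a where a: "a \<in> Z" "z \<in> ball a r" by blast
        have "indicat_real (ball b r) z = 0" if "b \<in> Z - {a}" for b
          using r(2)[of a b] a that by (auto simp: indicator_def disjoint_iff)
        then have "(\<Sum>b\<in>Z. indicat_real (ball b r) z) = indicat_real (ball a r) z"
          using fin a by (subst sum.remove[of Z a]) auto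
        then show ?thesis by simp
      next
        case False
        then have "(\<Sum>b\<in>Z. indicat_real (ball b r) z) = 0" by (intro sum.neutral) auto
        then show ?thesis by simp
      qed
      then have "(\<Sum>a\<in>Z. indicat_real (ball a r) z) * ?h z \<le> 1 * ?h z"
        by (intro mult_right_mono) (simp_all add: G0)
      then have "(\<Sum>a\<in>Z. indicat_real (ball a r) z * ?h z) \<le> ?h z"
        by (simp add: sum_distrib_right)
      then show "(\<Sum>a\<in>Z. ennreal (indicat_real (ball a r) z * ?h z)) \<le> ennreal (?h z)"
        by (simp add: sum_ennreal G0 ennreal_leI)
    qed
    finally show "(\<integral>\<^sup>+x. (\<Sum>a\<in>Z. ennreal (f i a x)) \<partial>lborel) \<le> (\<integral>\<^sup>+z. ennreal (?h z) \<partial>lborel)" .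
  qed
  finally show ?thesis by (simp only: \<epsilon>_def)
qed

section \<open>The adjugate and the condition of an eigenpair\<close>

text \<open>This is X - A. The coefficient ring is left general because \<open>pencil\<close> later
  supplies matrices whose entries are themselves polynomials.\<close>

definition cmat :: "'a::comm_ring_1^'n^'n \<Rightarrow> 'a poly^'n^'n" where
  "cmat A = (\<chi> i j. [:- A $ i $ j, if i = j then 1 else 0:])"

definition cpoly :: "'a::comm_ring_1^'n^'n \<Rightarrow> 'a poly" where
  "cpoly A = det (cmat A)"

text \<open>\<open>cofp k l A\<close> is the entry \<open>(l, k)\<close> of the adjugate of \<open>X - A\<close>.\<close>

definition cofp :: "'n \<Rightarrow> 'n \<Rightarrow> 'a::comm_ring_1^'n^'n \<Rightarrow> 'a poly" where
  "cofp k l A = det (\<chi> i. if i = k then axis l 1 else cmat A $ i)"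

lemma det_row_expand:
  fixes c :: "'n::finite \<Rightarrow> 'a::comm_ring_1^'n"
  shows "det (\<chi> i. if i = k then y else c i) = (\<Sum>l\<in>UNIV. y $ l * det (\<chi> i. if i = k then axis l 1 else c i))"
proof -
  have y: "y = (\<Sum>l\<in>UNIV. y $ l *s axis l 1)"
    by (simp add: vec_eq_iff axis_def if_distrib cong: if_cong)
  have "det (\<chi> i. if i = k then y else c i) = det (\<chi> i. if i = k then (\<Sum>l\<in>UNIV. y $ l *s axis l 1) else c i)"
    by (rule arg_cong[OF y, of "\<lambda>y. det (\<chi> i. if i = k then y else c i)"])
  also have "\<dots> = (\<Sum>l\<in>UNIV. det (\<chi> i. if i = k then y $ l *s axis l 1 else c i))"
    by (rule det_linear_row_sum) simp
  finally show ?thesis by (simp add: det_row_mul)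
qed

text \<open>Laplace expansion along row k after row i has been put in its place: for i = k nothing
  changes, otherwise two rows coincide.\<close>

lemma cofp_row:
  "(\<Sum>l\<in>UNIV. cmat A $ i $ l * cofp k l A) = (if i = k then cpoly A else 0)"
proof -
  have "(\<Sum>l\<in>UNIV. cmat A $ i $ l * cofp k l A) = det (\<chi> j. if j = k then cmat A $ i else cmat A $ j)"
    unfolding cofp_def by (rule det_row_expand[symmetric])
  also have "\<dots> = (if i = k then cpoly A else 0)"
  proof (cases "i = k")
    case True
    then have "(\<chi> j. if j = k then cmat A $ i else cmat A $ j) = cmat A" by (simp add: vec_eq_iff)
    then show ?thesis using True by (simp add: cpoly_def)
  next
    case False
    then show ?thesis by (auto intro!: det_identical_rows[of i k] simp: row_def vec_eq_iff)
  qed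
  finally show ?thesis .
qed

lemma cofp_eigen:
  "[:0, 1:] * cofp k i A - (\<Sum>l\<in>UNIV. smult (A $ i $ l) (cofp k l A)) = (if i = k then cpoly A else 0)"
proof -
  have "cmat A $ i $ l * q = (if l = i then [:0, 1:] * q else 0) - smult (A $ i $ l) q" for l q
    by (auto simp: cmat_def)
  then show ?thesis
    unfolding cofp_row[of A i k, symmetric] by (simp add: sum_subtractf)
qed

text \<open>Used for evaluation of polynomials at a point, and for evaluation of the coefficients of
  a polynomial over a polynomial ring.\<close>

lemma ring_hom_det:
  fixes h :: "'a::comm_ring_1 \<Rightarrow> 'b::comm_ring_1"
  assumes add: "\<And>a b. h (a + b) = h a + h b" and mult: "\<And>a b. h (a * b) = h a * h b" and one: "h 1 = 1"
  shows "h (det M) = det (\<chi> i j. h (M $ i $ j))"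
proof -
  have zero: "h 0 = 0" using add[of 0 0] by simp
  have neg: "h (- a) = - h a" for a using add[of a "- a"] zero by (simp add: eq_neg_iff_add_eq_0 add.commute)
  have sum: "h (sum f S) = (\<Sum>x\<in>S. h (f x))" if "finite S" for f and S :: "('c \<Rightarrow> 'c) set"
    using that by induction (simp_all add: zero add)
  have prod: "h (prod f S) = (\<Prod>x\<in>S. h (f x))" if "finite S" for f and S :: "'c set"
    using that by induction (simp_all add: one mult)
  have sign: "h (of_int (sign p)) = of_int (sign p)" for p :: "'c \<Rightarrow> 'c"
    by (simp add: sign_def one neg)
  show ?thesis
    unfolding det_def by (simp add: sum mult prod sign)
qed

lemma poly_det: "poly (det M) x = det (\<chi> i j. poly (M $ i $ j) x)"
  by (rule ring_hom_det) auto

lemma coeff_mult_top: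
  assumes "degree p \<le> m" "degree q \<le> n"
  shows "coeff (p * q) (m + n) = coeff p m * coeff q n"
proof -
  have "coeff (p * q) (m + n) = (\<Sum>i\<le>m + n. coeff p i * coeff q (m + n - i))"
    by (simp add: coeff_mult)
  also have "\<dots> = (\<Sum>i\<le>m + n. if i = m then coeff p m * coeff q n else 0)"
  proof (rule sum.cong)
    fix i
    show "coeff p i * coeff q (m + n - i) = (if i = m then coeff p m * coeff q n else 0)"
      using assms by (cases i m rule: linorder_cases) (auto simp: coeff_eq_0)
  qed simp
  finally show ?thesis by simp
qed

lemma degree_coeff_prod:
  fixes f :: "'b \<Rightarrow> 'a::comm_ring_1 poly"
  assumes "finite S" "\<And>i. i \<in> S \<Longrightarrow> degree (f i) \<le> d i"
  shows "degree (\<Prod>i\<in>S. f i) \<le> (\<Sum>i\<in>S. d i) \<and> coeff (\<Prod>i\<in>S. f i) (\<Sum>i\<in>S. d i) = (\<Prod>i\<in>S. coeff (f i) (d i))"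
  using assms
proof (induction S)
  case (insert x S)
  then have IH: "degree (\<Prod>i\<in>S. f i) \<le> (\<Sum>i\<in>S. d i)" "coeff (\<Prod>i\<in>S. f i) (\<Sum>i\<in>S. d i) = (\<Prod>i\<in>S. coeff (f i) (d i))"
    by auto
  have "degree (f x) \<le> d x" using insert.prems by simp
  then show ?case
    using insert.hyps IH
    by (auto intro!: order_trans[OF degree_mult_le] add_mono simp: coeff_mult_top)
qed simp

text \<open>Every term of the Leibniz expansion takes one factor from each row, so row bounds add
  up. With all bounds 1 it gives a monic characteristic polynomial of degree n; bound 0 in the
  replaced row gives degree at most n - 1 for cofactors.\<close>

lemma degree_coeff_det:
  fixes M :: "'a::comm_ring_1 poly^'n^'n"
  assumes "\<And>i j. degree (M $ i $ j) \<le> d i"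
  shows "degree (det M) \<le> sum d UNIV \<and> coeff (det M) (sum d UNIV) = det (\<chi> i j. coeff (M $ i $ j) (d i))"
proof -
  have s: "of_int (sign p) * q = smult (of_int (sign p)) q" for p :: "'n \<Rightarrow> 'n" and q :: "'a poly"
    by (simp add: sign_def)
  have *: "degree (\<Prod>i\<in>UNIV. M $ i $ p i) \<le> sum d UNIV \<and>
      coeff (\<Prod>i\<in>UNIV. M $ i $ p i) (sum d UNIV) = (\<Prod>i\<in>UNIV. coeff (M $ i $ p i) (d i))" for p
    by (rule degree_coeff_prod) (auto intro: assms)
  show ?thesis
    unfolding det_def s
    using * by (auto intro!: degree_sum_le order_trans[OF degree_smult_le] simp: coeff_sum)
qed

section \<open>Orthogonal projection and the operator A_{lambda,v}\<close>

lemma cinner_simps: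
  "cinner (a + b) v = cinner a v + cinner b v" "cinner (a - b) v = cinner a v - cinner b v"
  "cinner (c *s a) v = c * cinner a v" "cinner 0 v = 0"
  by (simp_all add: cinner_def algebra_simps sum.distrib sum_subtractf sum_distrib_left)

lemma cinner_self: "cinner v v = of_real ((norm v)\<^sup>2)"
  by (simp only: cinner_def norm_power2_vec of_real_sum complex_norm_square)

lemma cinner_self_eq_0: "cinner v v = 0 \<longleftrightarrow> v = 0"
  by (simp add: cinner_self)

lemma norm_smult_vec: "norm (c *s (v :: complex^'n)) = cmod c * norm v"
proof -
  have "(norm (c *s v))\<^sup>2 = (cmod c * norm v)\<^sup>2"
    by (simp add: norm_power2_vec norm_mult power_mult_distrib sum_distrib_left)
  then show ?thesis by (rule power2_eq_imp_eq) simp_all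
qed

lemma Pperp_add: "Pperp v (a + b) = Pperp v a + Pperp v b"
  by (simp add: Pperp_def cinner_simps vec_eq_iff add_divide_distrib algebra_simps)

lemma Pperp_smult: "Pperp v (c *s a) = c *s Pperp v a"
  by (simp add: Pperp_def cinner_simps vec_eq_iff algebra_simps)

lemma Pperp_sum: "Pperp v (\<Sum>i\<in>S. f i) = (\<Sum>i\<in>S. Pperp v (f i))"
proof (induction S rule: infinite_finite_induct)
  case (insert x S) then show ?case by (simp add: Pperp_add)
qed (simp_all add: Pperp_def cinner_simps)

lemma Pperp_self: "Pperp v (c *s v) = 0"
  by (cases "v = 0") (simp_all add: Pperp_def cinner_simps cinner_self_eq_0)

lemma cinner_Pperp: "cinner (Pperp v w) v = 0"
proof (cases "v = 0")
  case True then show ?thesis by (simp add: cinner_def)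
next
  case False then show ?thesis by (simp add: Pperp_def cinner_simps cinner_self_eq_0)
qed

lemma Pperp_Tsp: "w \<in> Tsp v \<Longrightarrow> Pperp v w = w"
  by (simp add: Pperp_def Tsp_def)

lemma Pperp_scale: "c \<noteq> 0 \<Longrightarrow> Pperp (c *s v) w = Pperp v w"
proof -
  assume c: "c \<noteq> 0"
  have "cinner w (c *s v) = cnj c * cinner w v"
    by (simp add: cinner_def sum_distrib_left mult_ac)
  moreover have "cinner (c *s v) (c *s v) = c * cnj c * cinner v v"
    by (simp add: cinner_def sum_distrib_left mult_ac)
  ultimately show ?thesis using c by (simp add: Pperp_def vec_eq_iff)
qed

text \<open>Pythagoras. It stays true at v = 0, where both quotients are 0 by convention;
  \<open>cofG_nonneg\<close> uses it at points where the curve may vanish.\<close>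

lemma norm_Pperp: "(norm (Pperp v w))\<^sup>2 = (norm w)\<^sup>2 - (cmod (cinner w v))\<^sup>2 / (norm v)\<^sup>2"
proof (cases "v = 0")
  case True then show ?thesis by (simp add: Pperp_def cinner_def)
next
  case False
  have cc: "cinner v w = cnj (cinner w v)" by (simp add: cinner_def mult.commute)
  have "cinner (Pperp v w) (Pperp v w) = cinner (Pperp v w) w"
  proof -
    have r: "cinner a (w - c *s v) = cinner a w - cnj c * cinner a v" for a c
      by (simp add: cinner_def algebra_simps sum_subtractf sum_distrib_left)
    show ?thesis
      by (subst (2) Pperp_def) (simp add: r cinner_Pperp)
  qed
  also have "\<dots> = cinner w w - cinner w v * cnj (cinner w v) / cinner v v"
    by (simp add: Pperp_def cinner_simps cc)
  finally have "complex_of_real ((norm (Pperp v w))\<^sup>2) = of_real ((norm w)\<^sup>2 - (cmod (cinner w v))\<^sup>2 / (norm v)\<^sup>2)"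
    by (simp only: cinner_self complex_norm_square[symmetric] of_real_diff of_real_divide)
  then show ?thesis by (simp only: of_real_eq_iff)
qed

lemma Alv_add: "Alv A l v (a + b) = Alv A l v a + Alv A l v b"
  unfolding Alv_def Pperp_add[symmetric]
  by (rule arg_cong[where f="Pperp v"]) (simp add: vec.add algebra_simps vector_add_ldistrib)

lemma Alv_smult: "Alv A l v (c *s a) = c *s Alv A l v a"
  unfolding Alv_def Pperp_smult[symmetric]
  by (rule arg_cong[where f="Pperp v"]) (simp add: vec.scale vec_eq_iff algebra_simps)

lemma Alv_sum: "Alv A l v (\<Sum>i\<in>S. f i) = (\<Sum>i\<in>S. Alv A l v (f i))"
proof (induction S rule: infinite_finite_induct)
  case (insert x S) then show ?case by (simp add: Alv_add)
qed (simp_all add: Alv_def Pperp_def cinner_simps)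

lemma Alv_in_Tsp: "Alv A l v w \<in> Tsp v"
  by (simp add: Alv_def Tsp_def cinner_Pperp)

text \<open>The multiple of v that the projection removes is annihilated by A - l.\<close>

lemma Alv_Pperp:
  assumes "A *v v = l *s v"
  shows "Alv A l v (Pperp v w) = Alv A l v w"
proof -
  have "A *v Pperp v w - l *s Pperp v w = A *v w - l *s w"
    unfolding Pperp_def by (simp add: vec.diff vec.scale assms vec_eq_iff algebra_simps)
  then show ?thesis by (simp add: Alv_def)
qed

lemma norm_sum_smult_le:
  fixes b :: "'n::finite \<Rightarrow> complex^'m"
  shows "norm (\<Sum>k\<in>UNIV. y $ k *s b k) \<le> norm y * sqrt (\<Sum>k\<in>UNIV. (norm (b k))\<^sup>2)"
proof -
  have "norm (\<Sum>k\<in>UNIV. y $ k *s b k) \<le> (\<Sum>k\<in>UNIV. \<bar>cmod (y $ k)\<bar> * \<bar>norm (b k)\<bar>)"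
    by (rule order_trans[OF norm_sum]) (simp add: norm_smult_vec)
  also have "\<dots> \<le> L2_set (\<lambda>k. cmod (y $ k)) UNIV * L2_set (\<lambda>k. norm (b k)) UNIV"
    by (rule L2_set_mult_ineq)
  finally show ?thesis by (simp add: norm_vec_def L2_set_def)
qed

text \<open>By hypothesis the operator sends P w_k to -d P e_k. Preimages of the projected standard
  basis are thus explicit, and Cauchy-Schwarz over k bounds the inverse that they define.\<close>

lemma inv_opnorm_le:
  fixes Q :: "complex^'n^'n" and w :: "'n \<Rightarrow> complex^'n"
  assumes eig: "Q *v u = l *s u" and d: "d \<noteq> 0"
    and w: "\<And>k. Q *v w k - l *s w k = c k *s u - d *s axis k 1"
  shows "inv_opnorm Q l u \<le> ennreal (sqrt (\<Sum>k\<in>UNIV. (norm (Pperp u (w k)))\<^sup>2) / cmod d)"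
proof -
  let ?A = "Alv Q l u" and ?T = "Tsp u"
  \<comment> \<open>The candidate inverse: expand y in the standard basis and replace each e_k by
    its preimage -(1 / d) P w_k.\<close>
  define B where "B y = (- (1 / d)) *s (\<Sum>k\<in>UNIV. y $ k *s Pperp u (w k))" for y
  have Ae: "?A (Pperp u (w k)) = (- d) *s Pperp u (axis k 1)" for k
  proof -
    have "?A (Pperp u (w k)) = Pperp u (c k *s u + (- d) *s axis k 1)"
      unfolding Alv_Pperp[OF eig] unfolding Alv_def w by (rule arg_cong[where f="Pperp u"]) (simp add: vec_eq_iff)
    then show ?thesis by (simp only: Pperp_add Pperp_self Pperp_smult) simp
  qed
  have AB: "?A (B y) = y" if "y \<in> ?T" for y
  proof -
    have "?A (B y) = (\<Sum>k\<in>UNIV. y $ k *s Pperp u (axis k 1))"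
      unfolding B_def Alv_smult Alv_sum Ae using d
      by (simp add: vec_eq_iff sum_distrib_left sum_negf)
    also have "\<dots> = Pperp u (\<Sum>k\<in>UNIV. y $ k *s axis k 1)"
      by (simp only: Pperp_sum Pperp_smult)
    also have "(\<Sum>k\<in>UNIV. y $ k *s axis k 1) = y"
      by (simp add: vec_eq_iff axis_def if_distrib cong: if_cong)
    finally show ?thesis using that by (simp add: Pperp_Tsp)
  qed
  have BT: "B y \<in> ?T" for y
  proof -
    have "B y = Pperp u ((- (1 / d)) *s (\<Sum>k\<in>UNIV. y $ k *s w k))"
      by (simp only: B_def Pperp_sum Pperp_smult)
    then show ?thesis by (simp add: Tsp_def cinner_Pperp)
  qed
  have inj: "inj_on ?A ?T"
  proof (rule inj_onI)
    \<comment> \<open>Adding the identity on the line of u extends the operator to an endomorphism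
      of the whole space. \<open>B\<close> makes it surjective, so finite dimension makes it
      injective.\<close>
    define M where "M x = ?A x + (x - Pperp u x)" for x
    have r: "r *\<^sub>R x = complex_of_real r *s x" for r and x :: "complex^'n"
      unfolding vec_eq_iff vector_scaleR_component vector_smult_component by (simp add: scaleR_conv_of_real)
    have diff: "Pperp u (a - b) = Pperp u a - Pperp u b" for a b
      using Pperp_add[of u "a - b" b] by simp
    have lin: "linear M"
    proof (rule linearI)
      show "M (a + b) = M a + M b" for a b by (simp add: M_def Alv_add Pperp_add)
      show "M (t *\<^sub>R a) = t *\<^sub>R M a" for t a
        unfolding r M_def Alv_smult Pperp_smult by (simp add: vec_eq_iff algebra_simps)
    qed
    have "surj M"
    proof (rule surjI)
      fix y
      have PT: "Pperp u y \<in> ?T" by (simp add: Tsp_def cinner_Pperp)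
      have PP: "Pperp u (Pperp u y) = Pperp u y" by (rule Pperp_Tsp[OF PT])
      have "?A (y - Pperp u y) = 0"
        using Alv_add[of Q l u "y - Pperp u y" "Pperp u y"] by (simp add: Alv_Pperp[OF eig])
      then show "M (B (Pperp u y) + (y - Pperp u y)) = y"
        by (simp add: M_def Alv_add AB[OF PT] Pperp_add Pperp_Tsp[OF BT] diff PP)
    qed
    then have inj: "inj M" by (intro linear_surjective_imp_injective[OF lin]) simp_all
    fix x y assume "x \<in> ?T" "y \<in> ?T" "?A x = ?A y"
    then have "M x = M y" by (simp add: M_def Pperp_Tsp)
    with inj show "x = y" by (rule injD)
  qed
  have "?A ` ?T = ?T"
  proof (rule antisym)
    show "?A ` ?T \<subseteq> ?T" using Alv_in_Tsp by blast
    show "?T \<subseteq> ?A ` ?T" using AB BT by (metis image_eqI subsetI)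
  qed
  with inj have bij: "bij_betw ?A ?T ?T" by (simp add: bij_betw_def)
  have "norm (inv_into ?T ?A y) / norm y \<le> sqrt (\<Sum>k\<in>UNIV. (norm (Pperp u (w k)))\<^sup>2) / cmod d"
    if y: "y \<in> ?T - {0}" for y
  proof -
    have "inv_into ?T ?A y = B y"
      using inv_into_f_f[OF inj BT[of y]] AB[of y] y by simp
    then have "norm (inv_into ?T ?A y) \<le> norm y * sqrt (\<Sum>k\<in>UNIV. (norm (Pperp u (w k)))\<^sup>2) / cmod d"
      using norm_sum_smult_le[of y "\<lambda>k. Pperp u (w k)"]
      by (simp add: B_def norm_smult_vec norm_divide divide_right_mono)
    then show ?thesis using y by (simp add: field_simps)
  qed
  then show ?thesis
    unfolding inv_opnorm_def if_P[OF bij] by (intro SUP_least ennreal_leI) 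
qed

section \<open>Adjugate columns as eigenvectors\<close>

lemma det_eq_0_iff_kernel:
  fixes M :: "complex^'n^'n"
  shows "det M = 0 \<longleftrightarrow> (\<exists>x. x \<noteq> 0 \<and> M *v x = 0)"
  using invertible_det_nz[of M] matrix_left_invertible_ker[of M] invertible_left_inverse[of M] by blast

lemma poly_cmat: "(\<chi> i j. poly (cmat Q $ i $ j) z) *v x = z *s x - (Q :: complex^'n^'n) *v x"
proof -
  have "poly (cmat Q $ i $ j) z * x $ j = (if j = i then z * x $ j else 0) - Q $ i $ j * x $ j" for i j
    by (simp add: cmat_def algebra_simps)
  then show ?thesis
    by (simp add: vec_eq_iff matrix_vector_mult_def sum_subtractf)
qed

lemma poly_cpoly: "poly (cpoly Q) z = det (\<chi> i j. poly (cmat Q $ i $ j) z)"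
  by (simp add: cpoly_def poly_det)

lemma eigvals_iff: "z \<in> eigvals Q \<longleftrightarrow> poly (cpoly Q) z = 0"
proof -
  have "z *s x - Q *v x = 0 \<longleftrightarrow> Q *v x = z *s x" for x by auto
  then show ?thesis unfolding eigvals_def poly_cpoly det_eq_0_iff_kernel poly_cmat by simp
qed

definition cofv :: "'n \<Rightarrow> complex^'n^'n \<Rightarrow> complex \<Rightarrow> complex^'n" where
  "cofv k Q z = (\<chi> l. poly (cofp k l Q) z)"

definition cofv' :: "'n \<Rightarrow> complex^'n^'n \<Rightarrow> complex \<Rightarrow> complex^'n" where
  "cofv' k Q z = (\<chi> l. poly (pderiv (cofp k l Q)) z)"

lemma poly_cofp: "poly (cofp k l Q) z = det (\<chi> i. if i = k then axis l 1 else (\<chi> j. poly (cmat Q $ i $ j) z))"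
  unfolding cofp_def poly_det
  by (rule arg_cong[where f=det]) (auto simp: vec_eq_iff axis_def)

lemma cofv_eq: "z *s cofv k Q z - Q *v cofv k Q z = poly (cpoly Q) z *s axis k 1"
proof -
  have "poly ([:0, 1:] * cofp k i Q - (\<Sum>l\<in>UNIV. smult (Q $ i $ l) (cofp k l Q))) z
      = poly (if i = k then cpoly Q else 0) z" for i
    by (simp only: cofp_eigen)
  then show ?thesis
    by (auto simp: vec_eq_iff cofv_def matrix_vector_mult_def poly_sum axis_def)
qed

lemma cofv'_eq: "cofv k Q z + (z *s cofv' k Q z - Q *v cofv' k Q z) = poly (pderiv (cpoly Q)) z *s axis k 1"
proof -
  have pd: "pderiv (sum f S) = (\<Sum>l\<in>S. pderiv (f l))" for f :: "'n \<Rightarrow> complex poly" and S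
    by (induction S rule: infinite_finite_induct) (simp_all add: pderiv_add)
  have "poly (cofp k i Q) z + (z * poly (pderiv (cofp k i Q)) z
      - (\<Sum>l\<in>UNIV. Q $ i $ l * poly (pderiv (cofp k l Q)) z))
      = poly (pderiv ([:0, 1:] * cofp k i Q - (\<Sum>l\<in>UNIV. smult (Q $ i $ l) (cofp k l Q)))) z" for i
    by (simp only: pderiv_diff pderiv_mult pd pderiv_smult) (simp add: pderiv_pCons poly_sum)
  moreover have "poly (pderiv ([:0, 1:] * cofp k i Q - (\<Sum>l\<in>UNIV. smult (Q $ i $ l) (cofp k l Q)))) z
     = poly (pderiv (if i = k then cpoly Q else 0)) z" for i
    by (simp only: cofp_eigen)
  ultimately have "poly (cofp k i Q) z + (z * poly (pderiv (cofp k i Q)) z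
      - (\<Sum>l\<in>UNIV. Q $ i $ l * poly (pderiv (cofp k l Q)) z))
      = poly (pderiv (if i = k then cpoly Q else 0)) z" for i by simp
  then show ?thesis
    by (simp add: vec_eq_iff cofv_def cofv'_def matrix_vector_mult_def axis_def)
qed

text \<open>A nonzero cofactor forces a one-dimensional eigenspace. Subtract from u the multiple of
  the column v that kills coordinate l; the difference lies in the kernel of z - Q with row k
  replaced by e_l, a matrix with determinant v_l, which is nonzero. Hence the eigenvector picked by
  \<open>SOME\<close> in \<open>mu_av_sq\<close> is a multiple of the column.\<close>

lemma cofv_kernel:
  assumes nz: "cofv k Q z \<noteq> 0" and z: "poly (cpoly Q) z = 0" and u: "u \<noteq> 0" "Q *v u = z *s u"
  shows "\<exists>c. c \<noteq> 0 \<and> cofv k Q z = c *s u"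
proof -
  obtain l where l: "poly (cofp k l Q) z \<noteq> 0" using nz by (auto simp: cofv_def vec_eq_iff)
  let ?v = "cofv k Q z"
  define x where "x = u - (u $ l / ?v $ l) *s ?v"
  have vl: "?v $ l \<noteq> 0" using l by (simp add: cofv_def)
  have xl: "x $ l = 0" using vl by (simp add: x_def)
  have v: "Q *v ?v = z *s ?v" using cofv_eq[of z k Q] z by simp
  have "z *s x - Q *v x = 0"
    by (simp add: x_def vec.diff vec.scale u v vec_eq_iff algebra_simps)
  then have ker: "(\<chi> i j. poly (cmat Q $ i $ j) z) *v x = 0" by (simp add: poly_cmat)
  have "(\<chi> i. if i = k then axis l 1 else (\<chi> j. poly (cmat Q $ i $ j) z)) *v x = 0"
  proof -
    have "(\<Sum>j\<in>UNIV. axis l 1 $ j * x $ j) = x $ l"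
      by (simp add: axis_def if_distrib[where f="\<lambda>a. a * _"] cong: if_cong)
    then show ?thesis
      using ker xl by (auto simp: vec_eq_iff matrix_vector_mult_def)
  qed
  with l have "x = 0" unfolding poly_cofp det_eq_0_iff_kernel by blast
  then have eq: "u = (u $ l / ?v $ l) *s ?v" by (simp add: x_def)
  define a where "a = u $ l / ?v $ l"
  have eq: "u = a *s ?v" using eq by (simp only: a_def)
  have a: "a \<noteq> 0" using u(1) eq by (metis vector_smult_lzero)
  have "(1 / a) *s u = (1 / a) *s (a *s ?v)" by (rule arg_cong[OF eq])
  also have "\<dots> = ?v" using a by simp
  finally show ?thesis using a by (intro exI[of _ "1 / a"]) simp
qed

text \<open>The squared norm of the projection of \<open>cofv'\<close> onto the orthogonal complement of \<open>cofv\<close>; where \<open>cofv\<close>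
  vanishes, division by zero makes it the squared norm of \<open>cofv'\<close>.\<close>

definition cofG :: "'n \<Rightarrow> complex^'n^'n \<Rightarrow> complex \<Rightarrow> real" where
  "cofG k Q z = (norm (cofv' k Q z))\<^sup>2 - (cmod (cinner (cofv' k Q z) (cofv k Q z)))\<^sup>2 / (norm (cofv k Q z))\<^sup>2"

lemma cofG_nonneg: "cofG k Q z \<ge> 0"
  unfolding cofG_def norm_Pperp[symmetric] by simp

text \<open>All columns are multiples of the same u, so one projection serves every k, and rescaling
  identifies it with the projection behind \<open>cofG\<close>. The derivative identity
  \<open>cofv'_eq\<close> supplies the hypothesis of \<open>inv_opnorm_le\<close> with d =
  p'(z).\<close>

lemma inv_opnorm_square_le:
  assumes z: "poly (cpoly Q) z = 0" and d: "poly (pderiv (cpoly Q)) z \<noteq> 0"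
    and nz: "\<And>k. cofv k Q z \<noteq> 0" and u: "u \<noteq> 0" "Q *v u = z *s u"
  shows "(inv_opnorm Q z u)\<^sup>2 \<le> (\<Sum>k\<in>UNIV. ennreal (cofG k Q z / (cmod (poly (pderiv (cpoly Q)) z))\<^sup>2))"
proof -
  let ?d = "poly (pderiv (cpoly Q)) z"
  obtain c where c: "\<And>k. c k \<noteq> 0" "\<And>k. cofv k Q z = c k *s u"
    using cofv_kernel[OF nz z u] by metis
  have "Q *v cofv' k Q z - z *s cofv' k Q z = c k *s u - ?d *s axis k 1" for k
    using cofv'_eq[of k Q z] unfolding c(2)[of k] by (simp add: algebra_simps)
  from inv_opnorm_le[OF u(2) d this]
  have le: "inv_opnorm Q z u \<le> ennreal (sqrt (\<Sum>k\<in>UNIV. (norm (Pperp u (cofv' k Q z)))\<^sup>2) / cmod ?d)" .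
  have "(norm (Pperp u (cofv' k Q z)))\<^sup>2 = cofG k Q z" for k
    unfolding cofG_def norm_Pperp[symmetric] by (simp add: c Pperp_scale)
  with le have "inv_opnorm Q z u \<le> ennreal (sqrt (\<Sum>k\<in>UNIV. cofG k Q z) / cmod ?d)" by simp
  then have "(inv_opnorm Q z u)\<^sup>2 \<le> (ennreal (sqrt (\<Sum>k\<in>UNIV. cofG k Q z) / cmod ?d))\<^sup>2"
    by (intro power_mono) simp_all
  also have "\<dots> = ennreal ((\<Sum>k\<in>UNIV. cofG k Q z) / (cmod ?d)\<^sup>2)"
    by (simp add: ennreal_power power_divide sum_nonneg cofG_nonneg)
  also have "\<dots> = (\<Sum>k\<in>UNIV. ennreal (cofG k Q z / (cmod ?d)\<^sup>2))"
    by (simp add: sum_divide_distrib sum_ennreal cofG_nonneg)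
  finally show ?thesis .
qed

lemma degree_cofp: "degree (cofp k l (A :: 'a::comm_ring_1^'n^'n)) \<le> CARD('n) - 1"
proof -
  let ?d = "\<lambda>i. if i = k then 0 else 1 :: nat"
  have "degree (cofp k l A) \<le> sum ?d UNIV"
    unfolding cofp_def
    by (rule conjunct1[OF degree_coeff_det]) (auto simp: cmat_def axis_def)
  also have "sum ?d UNIV = card (UNIV - {k})"
    by (simp add: sum.If_cases Collect_neg_eq Compl_eq_Diff_UNIV)
  finally show ?thesis by simp
qed

lemma degree_cpoly_le: "degree (cpoly (A :: 'a::comm_ring_1^'n^'n)) \<le> CARD('n)"
  and coeff_cpoly: "coeff (cpoly A) CARD('n) = 1"
proof -
  have "(\<chi> i j. coeff (cmat A $ i $ j) 1) = mat 1"
    by (auto simp: vec_eq_iff cmat_def mat_def)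
  then show "degree (cpoly A) \<le> CARD('n)" "coeff (cpoly A) CARD('n) = 1"
    using degree_coeff_det[of "cmat A" "\<lambda>_. 1"] by (auto simp: cpoly_def cmat_def)
qed

lemma degree_cpoly: "degree (cpoly (A :: 'a::comm_ring_1^'n^'n)) = CARD('n)"
  using degree_cpoly_le[of A] coeff_cpoly[of A] le_degree[of "cpoly A" "CARD('n)"] by simp

lemma continuous_on_det [continuous_intros]:
  fixes M :: "'b::topological_space \<Rightarrow> complex^'n^'n"
  assumes "\<And>i j. continuous_on S (\<lambda>x. M x $ i $ j)"
  shows "continuous_on S (\<lambda>x. det (M x))"
  unfolding det_def by (intro continuous_intros assms)

lemma continuous_poly_cpoly:
  "continuous_on UNIV (\<lambda>x :: (complex^'n^'n) \<times> complex. poly (cpoly (fst x)) (snd x))"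
  unfolding poly_cpoly by (rule continuous_on_det) (auto simp: cmat_def intro!: continuous_intros)

lemma continuous_poly_cofp:
  "continuous_on UNIV (\<lambda>x :: (complex^'n^'n) \<times> complex. poly (cofp k l (fst x)) (snd x))"
  unfolding poly_cofp
proof (rule continuous_on_det)
  fix i j
  show "continuous_on UNIV (\<lambda>x :: (complex^'n^'n) \<times> complex.
      (\<chi> i. if i = k then axis l 1 else \<chi> j. poly (cmat (fst x) $ i $ j) (snd x)) $ i $ j)"
    by (cases "i = k") (auto simp: cmat_def intro!: continuous_intros)
qed

section \<open>Expectation over the Gaussian matrix\<close>

text \<open>Row k is overwritten in the defining determinant. This keeps the curve fixed while row k
  is resampled.\<close>

lemma cofp_cong_rows:
  assumes "\<And>i. i \<noteq> k \<Longrightarrow> A $ i = B $ i"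
  shows "cofp k l A = cofp k l B"
proof -
  have "(\<chi> i. if i = k then axis l 1 else cmat A $ i) = (\<chi> i. if i = k then axis l 1 else cmat B $ i)"
    using assms by (simp add: vec_eq_iff cmat_def)
  then show ?thesis by (simp add: cofp_def)
qed

lemma cofG_cong_rows:
  assumes "\<And>i. i \<noteq> k \<Longrightarrow> A $ i = B $ i"
  shows "cofG k A z = cofG k B z"
  using cofp_cong_rows[OF assms] by (simp add: cofG_def cofv_def cofv'_def)

lemma poly_cpoly_row:
  fixes Q :: "complex^'n^'n"
  shows "poly (cpoly (Q + axis k (y - Q $ k))) z
    = z * poly (cofp k k Q) z - (\<Sum>l\<in>UNIV. y $ l * poly (cofp k l Q) z)"
proof -
  let ?R = "Q + axis k (y - Q $ k)"
  have c: "cofp k l ?R = cofp k l Q" for l by (rule cofp_cong_rows) (simp add: axis_def)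
  have r: "poly (cmat ?R $ k $ l) z = (if l = k then z else 0) - y $ l" for l
    by (cases "l = k") (simp_all add: cmat_def axis_def)
  have "cpoly ?R = (\<Sum>l\<in>UNIV. cmat ?R $ k $ l * cofp k l ?R)"
    by (simp only: cofp_row if_True simp_thms)
  then have "poly (cpoly ?R) z = (\<Sum>l\<in>UNIV. poly (cmat ?R $ k $ l) z * poly (cofp k l Q) z)"
    by (simp only: c poly_sum poly_mult)
  also have "\<dots> = (\<Sum>l\<in>UNIV. (if l = k then z * poly (cofp k k Q) z else 0) - y $ l * poly (cofp k l Q) z)"
    by (intro sum.cong refl, unfold r) (simp add: left_diff_distrib)
  finally show ?thesis by (simp add: sum_subtractf)
qed

text \<open>Difference quotients in z are jointly continuous, and their pointwise limit is the
  derivative.\<close>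

lemma borel_measurable_poly_pderiv_limit:
  fixes q :: "'b::topological_space \<Rightarrow> complex poly" 
  assumes "continuous_on UNIV (\<lambda>x :: 'b \<times> complex. poly (q (fst x)) (snd x))"
  shows "(\<lambda>x :: 'b \<times> complex. poly (pderiv (q (fst x))) (snd x)) \<in> borel_measurable borel"
proof (rule borel_measurable_LIMSEQ_metric)
  define e where "e i = complex_of_real (inverse (real (Suc i)))" for i
  have e: "e i \<noteq> 0" for i by (simp add: e_def del: of_nat_Suc)
  have lim: "filterlim e (at 0) sequentially"
    using tendsto_of_real[OF LIMSEQ_inverse_real_of_nat, where 'a=complex] e
    by (simp add: filterlim_at e_def[abs_def] del: of_real_inverse of_nat_Suc)
  show "(\<lambda>x :: 'b \<times> complex. (poly (q (fst x)) (snd x + e i) - poly (q (fst x)) (snd x)) / e i) \<in> borel_measurable borel" for i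
  proof (rule borel_measurable_continuous_onI)
    have "continuous_on UNIV ((\<lambda>x :: 'b \<times> complex. poly (q (fst x)) (snd x)) \<circ> (\<lambda>x. (fst x, snd x + e i)))"
      by (intro continuous_on_compose continuous_intros continuous_on_subset[OF assms]) auto
    then show "continuous_on UNIV (\<lambda>x :: 'b \<times> complex. (poly (q (fst x)) (snd x + e i) - poly (q (fst x)) (snd x)) / e i)"
      by (intro continuous_intros assms) (simp_all add: o_def e)
  qed
  fix x :: "'b \<times> complex"
  have "(\<lambda>h. (poly (q (fst x)) (snd x + h) - poly (q (fst x)) (snd x)) / h) \<midarrow>0\<rightarrow> poly (pderiv (q (fst x))) (snd x)"
    using poly_DERIV[of "q (fst x)" "snd x"] by (simp add: DERIV_def)
  from filterlim_compose[OF this lim]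
  show "(\<lambda>i. (poly (q (fst x)) (snd x + e i) - poly (q (fst x)) (snd x)) / e i)
      \<longlonglongrightarrow> poly (pderiv (q (fst x))) (snd x)" .
qed

lemma borel_measurable_cofG:
  "(\<lambda>x :: (complex^'n^'n) \<times> complex. cofG k (fst x) (snd x)) \<in> borel_measurable (borel \<Otimes>\<^sub>M borel)"
proof -
  have [measurable]: "(\<lambda>x :: (complex^'n^'n) \<times> complex. poly (cofp k l (fst x)) (snd x)) \<in> borel_measurable borel" for l
    by (rule borel_measurable_continuous_onI[OF continuous_poly_cofp])
  have [measurable]: "(\<lambda>x :: (complex^'n^'n) \<times> complex. poly (pderiv (cofp k l (fst x))) (snd x)) \<in> borel_measurable borel" for l
    by (rule borel_measurable_poly_pderiv_limit[OF continuous_poly_cofp])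
  have [measurable]: "cnj \<in> borel_measurable borel"
    by (intro borel_measurable_continuous_onI continuous_intros)
  show ?thesis
    unfolding borel_prod cofG_def cinner_def norm_power2_vec cofv_def cofv'_def vec_lambda_beta by measurable
qed

text \<open>Writing \<open>\<tau>\<close> + s |v|^2 as s (\<open>\<tau>\<close> / s + |v|^2)
  identifies e with \<open>\<tau>\<close> / s. Passing from |v|^2 to the larger denominator shrinks
  the subtracted term of \<open>cofG\<close>, which is the favourable direction.\<close>

lemma cofG_fs_dens:
  assumes \<tau>: "\<tau> > 0" and s: "s > 0"
  shows "cofG k Q z * (1 / (pi * (\<tau> + s * (\<Sum>l\<in>UNIV. (cmod (poly (cofp k l Q) z))\<^sup>2))))
    \<le> 1 / (pi * s) * fs_dens (\<tau> / s) (\<lambda>l. cofp k l Q) z"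
proof -
  define U where "U = (\<Sum>l\<in>UNIV. (cmod (poly (cofp k l Q) z))\<^sup>2)"
  define D where "D = \<tau> / s + U"
  let ?A = "\<Sum>l\<in>UNIV. (cmod (poly (pderiv (cofp k l Q)) z))\<^sup>2"
  let ?N = "fs_num (\<lambda>l. cofp k l Q) z"
  have U0: "U \<ge> 0" by (simp add: U_def sum_nonneg)
  have D: "D > 0" "D \<ge> U" using \<tau> s U0 by (simp_all add: D_def add_pos_nonneg)
  have G: "cofG k Q z = ?A - (cmod ?N)\<^sup>2 / U"
    by (simp add: cofG_def norm_power2_vec cofv_def cofv'_def cinner_def fs_num_def U_def)
  have fs: "fs_dens (\<tau> / s) (\<lambda>l. cofp k l Q) z = ?A / D - (cmod ?N)\<^sup>2 / D\<^sup>2"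
    by (simp add: fs_dens_def fs_den_def D_def U_def)
  \<comment> \<open>Where the curve vanishes the right side is 0 by the convention for division, but
    then \<open>?N\<close> is 0 too.\<close>
  have "(cmod ?N)\<^sup>2 / D \<le> (cmod ?N)\<^sup>2 / U"
  proof (cases "U = 0")
    case True
    then have "poly (cofp k l Q) z = 0" for l
      by (simp add: U_def sum_nonneg_eq_0_iff)
    then have "?N = 0" by (simp add: fs_num_def)
    then show ?thesis by simp
  next
    case False
    then show ?thesis using D U0 by (intro divide_left_mono) auto
  qed
  then have "cofG k Q z / D \<le> (?A - (cmod ?N)\<^sup>2 / D) / D"
    unfolding G using D by (intro divide_right_mono) auto
  also have "\<dots> = fs_dens (\<tau> / s) (\<lambda>l. cofp k l Q) z"
    unfolding fs by (simp add: diff_divide_distrib power2_eq_square)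
  finally have "1 / (pi * s) * (cofG k Q z / D) \<le> 1 / (pi * s) * fs_dens (\<tau> / s) (\<lambda>l. cofp k l Q) z"
    using s by (intro mult_left_mono) auto
  moreover have "\<tau> + s * U = s * D" using s by (simp add: D_def field_simps)
  ultimately show ?thesis by (simp add: U_def[symmetric] mult_ac)
qed

text \<open>The Kac-Rice integral with the Dirac mass at 0 smoothed to variance
  \<open>\<tau>\<close>; the factor |p'|^2 of the usual formula has cancelled against the weight 1 /
  |p'|^2 of the sum to be estimated.\<close>

definition root_kernel :: "'n \<Rightarrow> real \<Rightarrow> complex^'n^'n \<Rightarrow> ennreal" where
  "root_kernel k \<tau> Q = (\<integral>\<^sup>+z. ennreal (cofG k Q z * gdens \<tau> (poly (cpoly Q) z)) \<partial>lborel)"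

lemma borel_measurable_root_kernel [measurable]:
  "root_kernel k \<tau> \<in> borel_measurable (borel :: (complex^'n^'n) measure)"
proof -
  have [measurable]: "(\<lambda>x :: (complex^'n^'n) \<times> complex. poly (cpoly (fst x)) (snd x)) \<in> borel_measurable (borel \<Otimes>\<^sub>M borel)"
    unfolding borel_prod by (rule borel_measurable_continuous_onI[OF continuous_poly_cpoly])
  note [measurable] = borel_measurable_cofG[of k]
  have "(\<lambda>x :: (complex^'n^'n) \<times> complex. ennreal (cofG k (fst x) (snd x) * gdens \<tau> (poly (cpoly (fst x)) (snd x))))
     \<in> borel_measurable (borel \<Otimes>\<^sub>M lborel)"
    by measurable
  from lborel.borel_measurable_nn_integral_fst[OF this] show ?thesis
    by (simp add: root_kernel_def[abs_def])
qed

text \<open>For fixed z only the affine form depends on the row y, so after Fubini the density bound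
  applies pointwise and leaves 1 / (pi s) times an area of at most pi (n - 1). The result is uniform
  in \<open>\<tau>\<close> and in the other rows.\<close>

lemma root_kernel_row_expectation:
  fixes Q :: "complex^'n^'n" and m :: "complex^'n"
  assumes \<tau>: "\<tau> > 0" and s: "s > 0"
  shows "(\<integral>\<^sup>+y. root_kernel k \<tau> (Q + axis k (y - Q $ k)) * ennreal (gdens s (y - m)) \<partial>lborel)
     \<le> ennreal (real (CARD('n) - 1) / s)"
proof -
  let ?u = "\<lambda>l z. poly (cofp k l Q) z"
  let ?L = "\<lambda>y z. z * ?u k z - (\<Sum>l\<in>UNIV. y $ l * ?u l z)"
  have [measurable]: "(\<lambda>z. cofG k Q z) \<in> borel_measurable borel"
    unfolding cofG_def norm_power2_vec cinner_def cofv_def cofv'_def vec_lambda_beta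
    by (intro borel_measurable_diff borel_measurable_divide borel_measurable_continuous_onI continuous_intros)
  have [measurable]: "(\<lambda>x. ?L (fst x) (snd x)) \<in> borel_measurable (borel \<Otimes>\<^sub>M borel)"
    unfolding borel_prod by (intro borel_measurable_continuous_onI continuous_intros)
  have [measurable]: "(\<lambda>x. ?L (snd x) (fst x)) \<in> borel_measurable (borel \<Otimes>\<^sub>M borel)"
    unfolding borel_prod by (intro borel_measurable_continuous_onI continuous_intros)
  have "(\<integral>\<^sup>+y. root_kernel k \<tau> (Q + axis k (y - Q $ k)) * ennreal (gdens s (y - m)) \<partial>lborel)
    = (\<integral>\<^sup>+y. (\<integral>\<^sup>+z. ennreal (cofG k Q z) * (ennreal (gdens \<tau> (?L y z)) * ennreal (gdens s (y - m))) \<partial>lborel) \<partial>lborel)"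
  proof (rule nn_integral_cong)
    fix y
    have c: "cofG k (Q + axis k (y - Q $ k)) z = cofG k Q z" for z
      by (rule cofG_cong_rows) (simp add: axis_def)
    have [measurable]: "(\<lambda>z. ?L y z) \<in> borel_measurable borel"
      by (intro borel_measurable_continuous_onI continuous_intros)
    show "root_kernel k \<tau> (Q + axis k (y - Q $ k)) * ennreal (gdens s (y - m))
      = (\<integral>\<^sup>+z. ennreal (cofG k Q z) * (ennreal (gdens \<tau> (?L y z)) * ennreal (gdens s (y - m))) \<partial>lborel)"
      unfolding root_kernel_def c poly_cpoly_row
      by (subst nn_integral_multc[symmetric]) (simp_all add: ennreal_mult cofG_nonneg mult.assoc)
  qed
  also have "\<dots> = (\<integral>\<^sup>+z. (\<integral>\<^sup>+y. ennreal (cofG k Q z) * (ennreal (gdens \<tau> (?L y z)) * ennreal (gdens s (y - m))) \<partial>lborel) \<partial>lborel)"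
    by (rule lborel_pair.Fubini') measurable
  also have "\<dots> \<le> (\<integral>\<^sup>+z. ennreal (1 / (pi * s)) * ennreal (fs_dens (\<tau> / s) (\<lambda>l. cofp k l Q) z) \<partial>lborel)"
  proof (rule nn_integral_mono)
    fix z
    have "(\<integral>\<^sup>+y. ennreal (cofG k Q z) * (ennreal (gdens \<tau> (?L y z)) * ennreal (gdens s (y - m))) \<partial>lborel)
      = ennreal (cofG k Q z) * (\<integral>\<^sup>+y. ennreal (gdens \<tau> (?L y z)) * ennreal (gdens s (y - m)) \<partial>lborel)"
    proof (rule nn_integral_cmult)
      have [measurable]: "(\<lambda>y. ?L y z) \<in> borel_measurable borel"
        by (intro borel_measurable_continuous_onI continuous_intros)
      show "(\<lambda>y. ennreal (gdens \<tau> (?L y z)) * ennreal (gdens s (y - m))) \<in> borel_measurable lborel"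
        by measurable
    qed
    also have "\<dots> \<le> ennreal (cofG k Q z) * ennreal (1 / (pi * (\<tau> + s * (\<Sum>l\<in>UNIV. (cmod (?u l z))\<^sup>2))))"
      by (intro mult_left_mono gauss_linear_form_density_le s \<tau>) simp
    also have "\<dots> = ennreal (cofG k Q z * (1 / (pi * (\<tau> + s * (\<Sum>l\<in>UNIV. (cmod (?u l z))\<^sup>2)))))"
      by (rule ennreal_mult'[symmetric]) (rule cofG_nonneg)
    also have "\<dots> \<le> ennreal (1 / (pi * s) * fs_dens (\<tau> / s) (\<lambda>l. cofp k l Q) z)"
      by (intro ennreal_leI cofG_fs_dens \<tau> s)
    also have "\<dots> = ennreal (1 / (pi * s)) * ennreal (fs_dens (\<tau> / s) (\<lambda>l. cofp k l Q) z)"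
      using s by (intro ennreal_mult') simp
    finally show "(\<integral>\<^sup>+y. ennreal (cofG k Q z) * (ennreal (gdens \<tau> (?L y z)) * ennreal (gdens s (y - m))) \<partial>lborel)
      \<le> ennreal (1 / (pi * s)) * ennreal (fs_dens (\<tau> / s) (\<lambda>l. cofp k l Q) z)" .
  qed
  also have "\<dots> = ennreal (1 / (pi * s)) * (\<integral>\<^sup>+z. ennreal (fs_dens (\<tau> / s) (\<lambda>l. cofp k l Q) z) \<partial>lborel)"
  proof (rule nn_integral_cmult)
    have "fs_dens (\<tau> / s) (\<lambda>l. cofp k l Q) \<in> borel_measurable borel"
      using \<tau> s by (intro borel_measurable_continuous_onI continuous_intros) simp
    then show "(\<lambda>z. ennreal (fs_dens (\<tau> / s) (\<lambda>l. cofp k l Q) z)) \<in> borel_measurable lborel" by simp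
  qed
  also have "\<dots> \<le> ennreal (1 / (pi * s)) * ennreal (pi * real (CARD('n) - 1))"
    using \<tau> s by (intro mult_left_mono fs_area_le degree_cofp) simp_all
  also have "\<dots> = ennreal (real (CARD('n) - 1) / s)"
    using s by (subst ennreal_mult[symmetric]) simp_all
  finally show ?thesis .
qed

lemma root_kernel_expectation:
  fixes Qbar :: "complex^'n^'n"
  assumes \<tau>: "\<tau> > 0" and s: "s > 0"
  shows "(\<integral>\<^sup>+Q. root_kernel k \<tau> Q * ennreal (gdens s (Q - Qbar)) \<partial>lborel) \<le> ennreal (real (CARD('n) - 1) / s)"
proof -
  have "(\<integral>\<^sup>+Q. root_kernel k \<tau> Q * ennreal (gdens s (Q - Qbar)) \<partial>lborel)
    = (\<integral>\<^sup>+Q. (\<integral>\<^sup>+y. root_kernel k \<tau> (Q + axis k (y - Q $ k)) * ennreal (gdens s (y - Qbar $ k)) \<partial>lborel)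
          * ennreal (gdens s (Q - Qbar)) \<partial>lborel)"
    by (rule gauss_resample_component[OF s]) measurable
  also have "\<dots> \<le> (\<integral>\<^sup>+Q. ennreal (real (CARD('n) - 1) / s) * ennreal (gdens s (Q - Qbar)) \<partial>lborel)"
    by (intro nn_integral_mono mult_right_mono root_kernel_row_expectation \<tau> s) simp
  also have "\<dots> = ennreal (real (CARD('n) - 1) / s)"
    by (simp add: nn_integral_cmult gdens_total_shift[OF s])
  finally show ?thesis .
qed

text \<open>A Borel measurable majorant of the sum over eigenvalues for generic Q; the variances are
  the squares of the zoom scales 1 / (i + 1).\<close>

definition root_kernel_liminf :: "'n \<Rightarrow> complex^'n^'n \<Rightarrow> ennreal" where
  "root_kernel_liminf k Q = liminf (\<lambda>i. root_kernel k ((inverse (real (Suc i)))\<^sup>2) Q)"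

lemma borel_measurable_root_kernel_liminf [measurable]: "root_kernel_liminf k \<in> borel_measurable borel"
  unfolding root_kernel_liminf_def[abs_def] by measurable

lemma root_kernel_liminf_expectation:
  fixes Qbar :: "complex^'n^'n"
  assumes s: "s > 0"
  shows "(\<integral>\<^sup>+Q. ennreal (gdens s (Q - Qbar)) * root_kernel_liminf k Q \<partial>lborel) \<le> ennreal (real (CARD('n) - 1) / s)"
proof -
  let ?t = "\<lambda>i. (inverse (real (Suc i)))\<^sup>2"
  have "(\<integral>\<^sup>+Q. ennreal (gdens s (Q - Qbar)) * root_kernel_liminf k Q \<partial>lborel)
      = (\<integral>\<^sup>+Q. root_kernel_liminf k Q \<partial>density lborel (\<lambda>Q. ennreal (gdens s (Q - Qbar))))"
    by (simp add: nn_integral_density)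
  also have "\<dots> \<le> liminf (\<lambda>i. \<integral>\<^sup>+Q. root_kernel k (?t i) Q \<partial>density lborel (\<lambda>Q. ennreal (gdens s (Q - Qbar))))"
    unfolding root_kernel_liminf_def by (rule nn_integral_liminf) simp
  also have "\<dots> = liminf (\<lambda>i. \<integral>\<^sup>+Q. root_kernel k (?t i) Q * ennreal (gdens s (Q - Qbar)) \<partial>lborel)"
    by (simp add: nn_integral_density mult.commute)
  also have "\<dots> \<le> ennreal (real (CARD('n) - 1) / s)"
    by (intro Liminf_le always_eventually allI root_kernel_expectation s) simp_all
  finally show ?thesis .
qed

section \<open>Genericity\<close>

text \<open>\<open>mact p A x\<close> is \<open>p(A) x\<close>, by Horner's scheme.\<close>

definition mact :: "'a::comm_ring_1 poly \<Rightarrow> 'a^'n^'n \<Rightarrow> 'a^'n \<Rightarrow> 'a^'n" where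
  "mact p A x = fold_coeffs (\<lambda>a y. a *s x + A *v y) p 0"

lemma mact_0 [simp]: "mact 0 A x = 0"
  by (simp add: mact_def)

lemma mact_pCons [simp]: "mact (pCons a p) A x = a *s x + A *v mact p A x"
  by (cases "p = 0 \<and> a = 0") (auto simp: mact_def)

lemma mact_add: "mact (p + q) A x = mact p A x + mact q A x"
  by (induction p q rule: poly_induct2)
     (simp_all add: vec_eq_iff matrix_vector_mult_def sum.distrib algebra_simps)

lemma mact_smult: "mact (smult c p) A x = c *s mact p A x"
  by (induction p) (simp_all add: vec_eq_iff matrix_vector_mult_def sum_distrib_left algebra_simps)

lemma mact_vec_add: "mact p A (x + y) = mact p A x + mact p A y"
  by (induction p) (simp_all add: matrix_vector_right_distrib vector_add_ldistrib algebra_simps)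

lemma mact_vec_smult: "mact p A (c *s x) = c *s mact p A x"
  by (induction p) (simp_all add: vec_eq_iff matrix_vector_mult_def sum_distrib_left algebra_simps)

lemma mact_vec_sum: "finite S \<Longrightarrow> mact p A (\<Sum>j\<in>S. f j) = (\<Sum>j\<in>S. mact p A (f j))"
proof (induction S rule: finite_induct)
  case empty then show ?case using mact_vec_smult[of p A 0 0] by simp
qed (simp add: mact_vec_add)

text \<open>Exhibits p(A) as a matrix, so that its singularity can be read off a
  determinant.\<close>

lemma mact_matrix: "(\<chi> i j. mact p A (axis j 1) $ i) *v x = mact p A x"
proof -
  have "x = (\<Sum>j\<in>UNIV. x $ j *s axis j 1)"
    by (simp add: vec_eq_iff axis_def if_distrib cong: if_cong)
  then have "mact p A x = (\<Sum>j\<in>UNIV. x $ j *s mact p A (axis j 1))"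
    using mact_vec_sum[of UNIV p A "\<lambda>j. x $ j *s axis j 1"] by (simp add: mact_vec_smult)
  then show ?thesis by (simp add: vec_eq_iff matrix_vector_mult_def mult.commute)
qed

lemma mact_eigenvector:
  assumes "A *v v = z *s v"
  shows "mact p A v = poly p z *s v"
proof (induction p)
  case (pCons a p)
  have "A *v (poly p z *s v) = poly p z *s (A *v v)"
    by (simp add: vec_eq_iff matrix_vector_mult_def sum_distrib_left algebra_simps)
  then show ?case
    by (simp only: mact_pCons pCons.IH assms) (simp add: vec_eq_iff algebra_simps)
qed simp

text \<open>Over the complex numbers p(A) factors into a nonzero constant and operators A - r with r
  a root of p. No such r is an eigenvalue, so every factor is injective; the induction peels off one
  root at a time.\<close>

lemma mact_injective:
  fixes A :: "complex^'n^'n"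
  assumes "p \<noteq> 0" "\<And>z. poly (cpoly A) z = 0 \<Longrightarrow> poly p z \<noteq> 0" "mact p A x = 0"
  shows "x = 0"
  using assms
proof (induction "degree p" arbitrary: p x)
  case 0
  then obtain a where "p = [:a:]" by (metis degree_eq_zeroE)
  with 0 show ?case by (simp add: vec_eq_iff)
next
  case (Suc m)
  have "\<not> constant (poly p)" using Suc.hyps(2) by (simp add: constant_degree)
  then obtain r where r: "poly p r = 0" using fundamental_theorem_of_algebra by blast
  then obtain q where q: "p = [:- r, 1:] * q" by (auto simp: poly_eq_0_iff_dvd dvd_def)
  have q0: "q \<noteq> 0" using q Suc.prems(1) by auto
  have "degree ([:- r, 1:] * q) = 1 + degree q" using q0 by (subst degree_mult_eq) auto
  then have deg: "m = degree q" using q Suc.hyps(2) by simp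
  define y where "y = mact q A x"
  have "p = pCons 0 q + smult (- r) q" using q by simp
  then have "mact p A x = 0 *s x + A *v y + (- r) *s y"
    by (simp only: mact_add mact_smult mact_pCons y_def)
  then have "mact p A x = A *v y - r *s y" by (simp add: vec_eq_iff)
  then have "A *v y = r *s y" using Suc.prems(3) by simp
  then have "y = 0" using Suc.prems(2)[of r] r by (auto simp: eigvals_iff[symmetric] eigvals_def)
  then have mq: "mact q A x = 0" by (simp add: y_def)
  have "poly q z \<noteq> 0" if "poly (cpoly A) z = 0" for z
    using Suc.prems(2)[OF that] unfolding q by auto
  then show ?case by (rule Suc.hyps(1)[OF deg q0 _ mq])
qed

section \<open>Matrix pencils and lines of matrices\<close>

lemma map_poly_eval_hom:
  fixes p q :: "complex poly poly"
  shows "map_poly (\<lambda>c. poly c w) (p + q) = map_poly (\<lambda>c. poly c w) p + map_poly (\<lambda>c. poly c w) q"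
    and "map_poly (\<lambda>c. poly c w) (p * q) = map_poly (\<lambda>c. poly c w) p * map_poly (\<lambda>c. poly c w) q"
    and "map_poly (\<lambda>c. poly c w) (1 :: complex poly poly) = 1"
  by (auto intro!: poly_eqI simp: coeff_map_poly coeff_mult poly_sum coeff_1)

lemma map_poly_eval_det:
  fixes M :: "complex poly poly^'n^'n"
  shows "map_poly (\<lambda>c. poly c w) (det M) = det (\<chi> i j. map_poly (\<lambda>c. poly c w) (M $ i $ j))"
  by (rule ring_hom_det) (rule map_poly_eval_hom)+

text \<open>The parameter w multiplies Q, so the explicit good matrix D sits at w = 0. The line Q +
  t D is recovered as t times the pencil at w = 1 / t.\<close>

definition pencil :: "complex^'n^'n \<Rightarrow> complex^'n^'n \<Rightarrow> complex poly^'n^'n" where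
  "pencil D Q = (\<chi> i j. [:D $ i $ j, Q $ i $ j:])"

definition pencil_at :: "complex^'n^'n \<Rightarrow> complex^'n^'n \<Rightarrow> complex \<Rightarrow> complex^'n^'n" where
  "pencil_at D Q w = (\<chi> i j. D $ i $ j + w * Q $ i $ j)"

lemma map_poly_linear: "map_poly (\<lambda>c. poly c w) [:a, b:] = [:poly a w, poly b w:]"
  by (rule poly_eqI) (simp add: coeff_map_poly coeff_pCons split: nat.split)

lemma map_poly_cpoly_pencil: "map_poly (\<lambda>c. poly c w) (cpoly (pencil D Q)) = cpoly (pencil_at D Q w)"
  unfolding cpoly_def map_poly_eval_det
  by (rule arg_cong[where f=det]) (auto simp: vec_eq_iff cmat_def pencil_def pencil_at_def map_poly_linear)

lemma map_poly_cofp_pencil: "map_poly (\<lambda>c. poly c w) (cofp k l (pencil D Q)) = cofp k l (pencil_at D Q w)"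
  unfolding cofp_def map_poly_eval_det
  by (rule arg_cong[where f=det]) (auto simp: vec_eq_iff cmat_def pencil_def pencil_at_def map_poly_linear axis_def)

lemma map_poly_pderiv:
  "map_poly (\<lambda>c. poly c w) (pderiv (p :: complex poly poly)) = pderiv (map_poly (\<lambda>c. poly c w) p)"
  by (rule poly_eqI) (simp add: coeff_map_poly coeff_pderiv del: of_nat_Suc)

lemma cpoly_nonzero: "cpoly (A :: 'a::comm_ring_1^'n^'n) \<noteq> 0"
  using coeff_cpoly[of A] by (metis coeff_0 zero_neq_one)

lemma poly_mact_pencil:
  "poly (mact R (pencil D Q) x $ i) w
    = mact (map_poly (\<lambda>c. poly c w) R) (pencil_at D Q w) (\<chi> i. poly (x $ i) w) $ i"
proof (induction R arbitrary: i)
  case (pCons a R)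
  then show ?case
    by (simp add: map_poly_pCons matrix_vector_mult_def poly_sum pencil_def pencil_at_def algebra_simps)
qed simp

text \<open>If \<open>R\<close> has a root in common with the characteristic polynomial of \<open>A\<close>, then \<open>R(A)\<close> is
  singular, and \<open>det R(A)\<close> is polynomial in the parameter of a pencil.\<close>

lemma pencil_common_root_finite:
  fixes R :: "complex poly poly" and D Q :: "complex^'n^'n"
  assumes "\<And>z. poly (cpoly D) z = 0 \<Longrightarrow> poly (map_poly (\<lambda>c. poly c 0) R) z \<noteq> 0"
  shows "finite {w. \<exists>z. poly (cpoly (pencil_at D Q w)) z = 0 \<and> poly (map_poly (\<lambda>c. poly c w) R) z = 0}"
proof -
  let ?R = "\<lambda>w. map_poly (\<lambda>c. poly c w) R"
  define f where "f = det (\<chi> i j. mact R (pencil D Q) (axis j 1) $ i)"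
  have f: "poly f w = det (\<chi> i j. mact (?R w) (pencil_at D Q w) (axis j 1) $ i)" for w
  proof -
    have "(\<chi> i. poly (axis j 1 $ i) w) = axis j 1" for j :: 'n
      by (simp add: vec_eq_iff axis_def)
    then show ?thesis by (simp add: f_def poly_det poly_mact_pencil)
  qed
  have D: "pencil_at D Q 0 = D" by (simp add: pencil_at_def vec_eq_iff)
  \<comment> \<open>The hypothesis speaks only about eigenvalues of D; the existence of one shows
    that the specialised \<open>R\<close> is not the zero polynomial.\<close>
  have "\<not> constant (poly (cpoly D))" by (simp add: constant_degree degree_cpoly)
  then obtain z where "poly (cpoly D) z = 0" using fundamental_theorem_of_algebra by blast
  then have R0: "?R 0 \<noteq> 0" using assms by force
  have "poly f 0 \<noteq> 0"
    unfolding f D det_eq_0_iff_kernel mact_matrix using mact_injective[OF R0 assms] by blast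
  then have fin: "finite {w. poly f w = 0}" by (intro poly_roots_finite) auto
  have "poly f w = 0" if z: "poly (cpoly (pencil_at D Q w)) z = 0" "poly (?R w) z = 0" for w z
  proof -
    obtain v where v: "v \<noteq> 0" "pencil_at D Q w *v v = z *s v"
      using z(1) by (auto simp: eigvals_iff[symmetric] eigvals_def)
    have "mact (?R w) (pencil_at D Q w) v = 0"
      unfolding mact_eigenvector[OF v(2)] z(2) by simp
    then show ?thesis unfolding f det_eq_0_iff_kernel mact_matrix using v(1) by blast
  qed
  then show ?thesis by (intro finite_subset[OF _ fin]) blast
qed

lemma pencil_common_root_finite_pderiv:
  assumes "\<And>z. poly (cpoly D) z = 0 \<Longrightarrow> poly (pderiv (cpoly D)) z \<noteq> 0"
  shows "finite {w. \<exists>z. poly (cpoly (pencil_at D Q w)) z = 0 \<and> poly (pderiv (cpoly (pencil_at D Q w))) z = 0}"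
proof -
  have "pencil_at D Q 0 = D" by (simp add: pencil_at_def vec_eq_iff)
  then show ?thesis
    using pencil_common_root_finite[of D "pderiv (cpoly (pencil D Q))" Q] assms
    by (simp add: map_poly_cpoly_pencil map_poly_pderiv)
qed

lemma pencil_common_root_finite_cofp:
  assumes "\<And>z. poly (cpoly D) z = 0 \<Longrightarrow> poly (cofp k k D) z \<noteq> 0"
  shows "finite {w. \<exists>z. poly (cpoly (pencil_at D Q w)) z = 0 \<and> poly (cofp k k (pencil_at D Q w)) z = 0}"
proof -
  have "pencil_at D Q 0 = D" by (simp add: pencil_at_def vec_eq_iff)
  then show ?thesis
    using pencil_common_root_finite[of D "cofp k k (pencil D Q)" Q] assms
    by (simp add: map_poly_cofp_pencil)
qed

definition mscale :: "complex \<Rightarrow> complex^'n^'n \<Rightarrow> complex^'n^'n" where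
  "mscale c A = (\<chi> i j. c * A $ i $ j)"

lemma poly_cpoly_mscale:
  "poly (cpoly (mscale c A)) (c * z) = c ^ CARD('n) * poly (cpoly (A :: complex^'n^'n)) z"
proof -
  have "(\<chi> i j. poly (cmat (mscale c A) $ i $ j) (c * z)) = (\<chi> i. c *s (\<chi> j. poly (cmat A $ i $ j) z))"
    by (simp add: vec_eq_iff cmat_def mscale_def algebra_simps)
  then show ?thesis
    unfolding poly_cpoly using det_rows_mul[of "\<lambda>_. c" "\<lambda>i. \<chi> j. poly (cmat A $ i $ j) z"] by simp
qed

text \<open>The scaling rule holds at every point, hence as an identity of polynomials, and the
  chain rule differentiates it.\<close>

lemma poly_pderiv_cpoly_mscale:
  "c * poly (pderiv (cpoly (mscale c A))) (c * z) = c ^ CARD('n) * poly (pderiv (cpoly (A :: complex^'n^'n))) z"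
proof -
  have "pcompose (cpoly (mscale c A)) [:0, c:] = smult (c ^ CARD('n)) (cpoly A)"
    by (simp add: poly_eq_poly_eq_iff[symmetric] fun_eq_iff poly_pcompose poly_cpoly_mscale mult.commute[of _ c])
  then have "poly (pderiv (pcompose (cpoly (mscale c A)) [:0, c:])) z = poly (pderiv (smult (c ^ CARD('n)) (cpoly A))) z"
    by simp
  then show ?thesis
    by (simp add: pderiv_pcompose pderiv_smult poly_pcompose pderiv_pCons mult.commute[of z c])
qed

lemma poly_cofp_mscale:
  "poly (cofp k l (mscale c A)) (c * z) = (\<Prod>i\<in>UNIV. if i = k then 1 else c) * poly (cofp k l (A :: complex^'n^'n)) z"
proof -
  let ?r = "\<lambda>A z i. if i = k then axis l 1 else (\<chi> j. poly (cmat A $ i $ j) z)"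
  have "(\<chi> i. ?r (mscale c A) (c * z) i) = (\<chi> i. (if i = k then 1 else c) *s ?r A z i)"
    by (simp add: vec_eq_iff cmat_def mscale_def algebra_simps)
  then show ?thesis
    unfolding poly_cofp using det_rows_mul[of "\<lambda>i. if i = k then 1 else c" "?r A z"] by simp
qed

lemma line_eq_mscale_pencil:
  assumes "t \<noteq> 0"
  shows "Q + t *\<^sub>R D = mscale (of_real t) (pencil_at D Q (1 / of_real t))"
proof -
  have "(Q + t *\<^sub>R D) $ i $ j = Q $ i $ j + of_real t * D $ i $ j" for i j
    by (simp add: scaleR_conv_of_real[where 'a=complex])
  then show ?thesis
    using assms unfolding vec_eq_iff by (simp add: mscale_def pencil_at_def algebra_simps)
qed

text \<open>Rescaling by t carries common roots on the line to common roots on the pencil, so a bad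
  t is 0 or the reciprocal of a bad w.\<close>

lemma line_finite:
  fixes f :: "complex^'n^'n \<Rightarrow> complex \<Rightarrow> complex"
  assumes fin: "finite {w. \<exists>z. poly (cpoly (pencil_at D Q w)) z = 0 \<and> f (pencil_at D Q w) z = 0}"
    and scale: "\<And>c A z. c \<noteq> 0 \<Longrightarrow> f (mscale c A) (c * z) = 0 \<Longrightarrow> f A z = 0"
  shows "finite {t :: real. \<exists>z. poly (cpoly (Q + t *\<^sub>R D)) z = 0 \<and> f (Q + t *\<^sub>R D) z = 0}"
proof -
  let ?W = "{w. \<exists>z. poly (cpoly (pencil_at D Q w)) z = 0 \<and> f (pencil_at D Q w) z = 0}"
  have "{t :: real. \<exists>z. poly (cpoly (Q + t *\<^sub>R D)) z = 0 \<and> f (Q + t *\<^sub>R D) z = 0}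
    \<subseteq> insert 0 ((\<lambda>w. Re (1 / w)) ` ?W)"
  proof
    fix t assume "t \<in> {t :: real. \<exists>z. poly (cpoly (Q + t *\<^sub>R D)) z = 0 \<and> f (Q + t *\<^sub>R D) z = 0}"
    then obtain z where z: "poly (cpoly (Q + t *\<^sub>R D)) z = 0" "f (Q + t *\<^sub>R D) z = 0" by blast
    show "t \<in> insert 0 ((\<lambda>w. Re (1 / w)) ` ?W)"
    proof (cases "t = 0")
      case False
      define c where "c = complex_of_real t"
      have c: "c \<noteq> 0" using False by (simp add: c_def)
      have "z = c * (z / c)" using c by simp
      with z have "poly (cpoly (mscale c (pencil_at D Q (1 / c)))) (c * (z / c)) = 0"
        "f (mscale c (pencil_at D Q (1 / c))) (c * (z / c)) = 0"
        unfolding line_eq_mscale_pencil[OF False] c_def[symmetric] by simp_all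
      then have "poly (cpoly (pencil_at D Q (1 / c))) (z / c) = 0" "f (pencil_at D Q (1 / c)) (z / c) = 0"
        using scale[OF c] c unfolding poly_cpoly_mscale by simp_all
      then have "1 / c \<in> ?W" by blast
      moreover have "t = Re (1 / (1 / c))" by (simp add: c_def)
      ultimately show ?thesis by blast
    qed simp
  qed
  then show ?thesis using fin by (rule finite_subset[OF _ finite.insertI[OF finite_imageI]])
qed

text \<open>By translation invariance the measure of S equals its average over the translates by t D
  with t in [0, 1]. After Fubini the inner integral runs over finitely many t and vanishes.\<close>

lemma null_set_along_line:
  fixes S :: "'a::euclidean_space set"
  assumes [measurable]: "S \<in> sets borel" and fin: "\<And>x. finite {t::real. x + t *\<^sub>R D \<in> S}"
  shows "S \<in> null_sets lborel"
proof -
  have [measurable]: "(\<lambda>x :: real \<times> 'a. snd x + fst x *\<^sub>R D) \<in> borel_measurable (borel \<Otimes>\<^sub>M borel)"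
    "(\<lambda>x :: 'a \<times> real. fst x + snd x *\<^sub>R D) \<in> borel_measurable (borel \<Otimes>\<^sub>M borel)"
    unfolding borel_prod by (intro borel_measurable_continuous_onI continuous_intros)+
  have "emeasure lborel S = (\<integral>\<^sup>+x. indicator S x \<partial>lborel)" by simp
  also have "\<dots> = (\<integral>\<^sup>+t. indicator {0..1::real} t * (\<integral>\<^sup>+x. indicator S x \<partial>lborel) \<partial>lborel)"
    by (simp add: nn_integral_multc)
  also have "\<dots> = (\<integral>\<^sup>+t. (\<integral>\<^sup>+x. indicator {0..1::real} t * indicator S (x + t *\<^sub>R D) \<partial>lborel) \<partial>lborel)"
  proof (rule nn_integral_cong)
    fix t :: real
    have "(\<integral>\<^sup>+x. indicator S x \<partial>lborel) = (\<integral>\<^sup>+x. indicator S (x + t *\<^sub>R D) \<partial>lborel)"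
      by (rule nn_integral_lborel_translate[symmetric]) simp
    also have "indicator {0..1} t * \<dots> = (\<integral>\<^sup>+x. indicator {0..1} t * indicator S (x + t *\<^sub>R D) \<partial>lborel)"
      by (rule nn_integral_cmult[symmetric]) simp
    finally show "indicator {0..1} t * (\<integral>\<^sup>+x. indicator S x \<partial>lborel)
       = (\<integral>\<^sup>+x. indicator {0..1} t * indicator S (x + t *\<^sub>R D) \<partial>lborel)" .
  qed
  also have "\<dots> = (\<integral>\<^sup>+x. (\<integral>\<^sup>+t. indicator {0..1::real} t * indicator S (x + t *\<^sub>R D) \<partial>lborel) \<partial>lborel)"
    by (rule lborel_pair.Fubini') measurable
  also have "\<dots> = (\<integral>\<^sup>+x. 0 \<partial>(lborel :: 'a measure))"
  proof (rule nn_integral_cong)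
    fix x :: 'a
    have "AE t in lborel. t \<notin> {t::real. x + t *\<^sub>R D \<in> S}"
      using finite_imp_null_set_lborel[OF fin[of x]] by (rule AE_not_in)
    then have "(\<integral>\<^sup>+t. indicator {0..1::real} t * indicator S (x + t *\<^sub>R D) \<partial>lborel) = (\<integral>\<^sup>+t. 0 \<partial>(lborel :: real measure))"
      by (intro nn_integral_cong_AE) (auto elim!: eventually_mono)
    then show "(\<integral>\<^sup>+t. indicator {0..1::real} t * indicator S (x + t *\<^sub>R D) \<partial>lborel) = 0" by simp
  qed
  finally show ?thesis by (simp add: null_sets_def)
qed

text \<open>The projection of a closed set need not be closed, but restricting z to compact balls
  makes it so; the set is a countable union of closed sets.\<close>

lemma borel_common_zero_projection:
  fixes f g :: "'a::euclidean_space \<times> 'b::euclidean_space \<Rightarrow> complex"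
  assumes f: "continuous_on UNIV f" and g: "continuous_on UNIV g"
  shows "{x. \<exists>z. f (x, z) = 0 \<and> g (x, z) = 0} \<in> sets borel"
proof -
  let ?T = "{p :: 'b \<times> 'a. f (snd p, fst p) = 0} \<inter> {p. g (snd p, fst p) = 0}"
  have sw: "continuous_on UNIV (\<lambda>p :: 'b \<times> 'a. h (snd p, fst p))"
    if "continuous_on UNIV h" for h :: "'a \<times> 'b \<Rightarrow> complex"
    by (rule continuous_on_compose2[OF that]) (auto intro!: continuous_intros)
  have T: "closed ?T"
    using continuous_closed_vimage continuous_on_eq_continuous_at
    by (intro closed_Int closed_Collect_eq sw f g continuous_intros)
  have "{x. \<exists>z. f (x, z) = 0 \<and> g (x, z) = 0} = (\<Union>m::nat. {x. \<exists>z. z \<in> cball 0 (real m) \<and> (z, x) \<in> ?T})"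
    using real_arch_simple by (fastforce simp: dist_norm)
  moreover have "closed {x. \<exists>z. z \<in> cball 0 (real m) \<and> (z, x) \<in> ?T}" for m
    by (rule closed_compact_projection[OF _ T]) simp
  ultimately show ?thesis by auto
qed

text \<open>Jacobi's formula: the derivative is the trace of the adjugate. It gives joint continuity
  of p' in the matrix and the point, as the Borel argument requires.\<close>

lemma pderiv_cpoly: "pderiv (cpoly A) = (\<Sum>k\<in>UNIV. cofp k k (A :: complex^'n^'n))"
proof -
  have pd: "pderiv (sum f S) = (\<Sum>l\<in>S. pderiv (f l))" for f :: "('n \<Rightarrow> 'n) \<Rightarrow> complex poly" and S
    by (induction S rule: infinite_finite_induct) (simp_all add: pderiv_add)
  have s: "of_int (sign p) * q = smult (of_int (sign p)) q" for p :: "'n \<Rightarrow> 'n" and q :: "complex poly"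
    by (simp add: sign_def)
  have sm: "smult c (sum f S) = (\<Sum>x\<in>S. smult c (f x))" for c and f :: "'n \<Rightarrow> complex poly" and S
    by (induction S rule: infinite_finite_induct) (simp_all add: smult_add_right)
  have k: "pderiv (cmat A $ k $ j) = axis k 1 $ j" for k j
    by (simp add: cmat_def axis_def pderiv_pCons)
  have "pderiv (\<Prod>i\<in>UNIV. cmat A $ i $ p i)
     = (\<Sum>k\<in>UNIV. \<Prod>i\<in>UNIV. (if i = k then axis k 1 else cmat A $ i) $ p i)" for p
  proof -
    have "(\<Prod>i\<in>UNIV. (if i = k then axis k 1 else cmat A $ i) $ p i)
        = (\<Prod>i\<in>UNIV - {k}. cmat A $ i $ p i) * pderiv (cmat A $ k $ p k)" for k
      unfolding k by (subst prod.remove[of UNIV k]) (auto simp: mult.commute intro!: prod.cong)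
    then show ?thesis by (simp add: pderiv_prod)
  qed
  then show ?thesis
    unfolding cpoly_def cofp_def det_def s
    by (simp add: pd pderiv_smult sm sum.swap[of _ "UNIV :: 'n set"])
qed

lemma obtain_inj_complex:
  obtains d :: "'n::finite \<Rightarrow> complex" where "inj d"
proof -
  obtain e :: "'n \<Rightarrow> nat" where "inj e" using finite_imp_inj_to_nat_seg[of "UNIV :: 'n set"] by auto
  then have "inj (\<lambda>i. complex_of_nat (e i))" by (simp add: inj_def)
  then show ?thesis using that by blast
qed

text \<open>The good direction is a diagonal matrix with distinct entries, whose characteristic
  polynomial has only simple roots.\<close>

lemma AE_simple_roots: "AE Q :: complex^'n^'n in lborel. \<forall>z. poly (cpoly Q) z = 0 \<longrightarrow> poly (pderiv (cpoly Q)) z \<noteq> 0"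
proof -
  obtain d :: "'n \<Rightarrow> complex" where d: "inj d" by (rule obtain_inj_complex)
  define D :: "complex^'n^'n" where "D = (\<chi> i j. if i = j then d i else 0)"
  have cp: "cpoly D = (\<Prod>i\<in>UNIV. [:- d i, 1:])"
  proof -
    have "cpoly D = (\<Prod>i\<in>UNIV. cmat D $ i $ i)"
      unfolding cpoly_def by (rule det_diagonal) (simp add: cmat_def D_def)
    then show ?thesis by (simp add: cmat_def D_def)
  qed
  have D: "poly (pderiv (cpoly D)) z \<noteq> 0" if z0: "poly (cpoly D) z = 0" for z
  proof -
    obtain i where i: "z = d i" using z0 by (auto simp: cp poly_prod)
    have "poly (pderiv (cpoly D)) z = (\<Sum>a\<in>UNIV. \<Prod>j\<in>UNIV - {a}. z - d j)"
      by (simp add: cp pderiv_prod pderiv_pCons poly_sum poly_prod)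
    also have "\<dots> = (\<Prod>j\<in>UNIV - {i}. z - d j)"
    proof -
      have "(\<Sum>a\<in>UNIV - {i}. \<Prod>j\<in>UNIV - {a}. z - d j) = 0"
      proof (rule sum.neutral, rule ballI)
        fix a assume "a \<in> UNIV - {i}"
        then show "(\<Prod>j\<in>UNIV - {a}. z - d j) = 0" using i by (intro prod_zero) auto
      qed
      then show ?thesis by (subst sum.remove[of UNIV i]) simp_all
    qed
    also have "\<dots> \<noteq> 0" using d by (auto simp: i inj_eq)
    finally show ?thesis .
  qed
  have c: "continuous_on UNIV (\<lambda>x :: (complex^'n^'n) \<times> complex. poly (pderiv (cpoly (fst x))) (snd x))"
    unfolding pderiv_cpoly poly_sum by (intro continuous_intros continuous_poly_cofp)
  let ?S = "{Q :: complex^'n^'n. \<exists>z. poly (cpoly Q) z = 0 \<and> poly (pderiv (cpoly Q)) z = 0}"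
  have "?S \<in> null_sets lborel"
  proof (rule null_set_along_line)
    show "?S \<in> sets borel"
      using borel_common_zero_projection[OF continuous_poly_cpoly c] by simp
    show "finite {t. x + t *\<^sub>R D \<in> ?S}" for x
      unfolding mem_Collect_eq
    proof (rule line_finite[of _ _ "\<lambda>Q z. poly (pderiv (cpoly Q)) z"])
      show "finite {w. \<exists>z. poly (cpoly (pencil_at D x w)) z = 0 \<and> poly (pderiv (cpoly (pencil_at D x w))) z = 0}"
        by (rule pencil_common_root_finite_pderiv) (rule D)
      show "poly (pderiv (cpoly A)) z = 0" if "c \<noteq> 0" "poly (pderiv (cpoly (mscale c A))) (c * z) = 0"
        for c z and A :: "complex^'n^'n"
        using poly_pderiv_cpoly_mscale[of c A z] that by simp
    qed
  qed
  from AE_not_in[OF this] show ?thesis by (auto elim!: eventually_mono)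
qed

text \<open>The witness is an arrowhead matrix: its \<open>k\<close>-th principal minor is diagonal with distinct entries,
  none of which is an eigenvalue of the whole matrix.\<close>

lemma AE_cofp_nonzero: "AE Q :: complex^'n^'n in lborel. \<forall>z. poly (cpoly Q) z = 0 \<longrightarrow> poly (cofp k k Q) z \<noteq> 0"
proof -
  obtain d :: "'n \<Rightarrow> complex" where d: "inj d" by (rule obtain_inj_complex)
  define D :: "complex^'n^'n" where "D = (\<chi> i j. if i = j then (if i = k then 0 else d i) else if i = k \<or> j = k then 1 else 0)"
  have row: "(\<Sum>j\<in>UNIV. poly (cmat D $ i $ j) z * x $ j) = (z - d i) * x $ i - x $ k" if "i \<noteq> k" for i z x
  proof -
    have "poly (cmat D $ i $ j) z * x $ j = (if j = i then (z - d i) * x $ i else 0) - (if j = k then x $ k else 0)" for j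
      using that by (auto simp: cmat_def D_def)
    then show ?thesis by (simp add: sum_subtractf)
  qed
  have rowk: "(\<Sum>j\<in>UNIV. poly (cmat D $ k $ j) z * x $ j) = z * x $ k - (\<Sum>j\<in>UNIV - {k}. x $ j)" for z x
  proof -
    have "(\<Sum>j\<in>UNIV. poly (cmat D $ k $ j) z * x $ j)
      = z * x $ k + (\<Sum>j\<in>UNIV - {k}. - x $ j)"
      by (subst sum.remove[of UNIV k]) (auto simp: cmat_def D_def intro!: sum.cong)
    then show ?thesis by (simp add: sum_negf)
  qed
  have D: "poly (cofp k k D) z \<noteq> 0" if z: "poly (cpoly D) z = 0" for z
  proof
    assume "poly (cofp k k D) z = 0"
    then obtain x where x: "x \<noteq> 0" "(\<chi> i. if i = k then axis k 1 else (\<chi> j. poly (cmat D $ i $ j) z)) *v x = 0"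
      unfolding poly_cofp det_eq_0_iff_kernel by blast
    have xi: "(\<Sum>j\<in>UNIV. (if i = k then axis k 1 else (\<chi> j. poly (cmat D $ i $ j) z)) $ j * x $ j) = 0" for i
      using x(2) by (simp add: vec_eq_iff matrix_vector_mult_def)
    have xk: "x $ k = 0"
      using xi[of k] by (simp add: axis_def if_distrib[where f="\<lambda>a. a * _"] cong: if_cong)
    obtain i where i: "x $ i \<noteq> 0" using x(1) by (auto simp: vec_eq_iff)
    have ik: "i \<noteq> k" using i xk by auto
    \<comment> \<open>A root of the minor makes z one of the entries d_i: since x_k = 0, row i reads
      (z - d_i) x_i = 0.\<close>
    have zi: "z = d i" using xi[of i] row[OF ik, of z x] i xk ik by simp
    obtain y where y: "y \<noteq> 0" "(\<chi> i j. poly (cmat D $ i $ j) z) *v y = 0"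
      using z unfolding poly_cpoly det_eq_0_iff_kernel by blast
    have yj: "(\<Sum>j\<in>UNIV. poly (cmat D $ a $ j) z * y $ j) = 0" for a
      using y(2) by (simp add: vec_eq_iff matrix_vector_mult_def)
    \<comment> \<open>An eigenvector y for z = d_i is now eliminated: row i gives y_k = 0, the other
      rows leave at most y_i because the d_a are distinct, and row k kills y_i.\<close>
    have yk: "y $ k = 0" using yj[of i] row[OF ik, of z y] zi by simp
    have yo: "y $ a = 0" if "a \<noteq> k" "a \<noteq> i" for a
      using yj[of a] row[OF that(1), of z y] zi yk that d by (auto simp: inj_eq)
    have "(\<Sum>j\<in>UNIV - {k}. y $ j) = y $ i"
      using ik yo by (subst sum.remove[of _ i]) (auto intro!: sum.neutral)
    then have "y $ i = 0" using yj[of k] rowk[of z y] yk by simp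
    then have "y = 0" using yo yk by (metis vec_eq_iff zero_index)
    then show False using y(1) by simp
  qed
  let ?S = "{Q :: complex^'n^'n. \<exists>z. poly (cpoly Q) z = 0 \<and> poly (cofp k k Q) z = 0}"
  have "?S \<in> null_sets lborel"
  proof (rule null_set_along_line)
    show "?S \<in> sets borel"
      using borel_common_zero_projection[OF continuous_poly_cpoly continuous_poly_cofp[of k k]] by simp
    show "finite {t. x + t *\<^sub>R D \<in> ?S}" for x
      unfolding mem_Collect_eq
    proof (rule line_finite[of _ _ "\<lambda>Q z. poly (cofp k k Q) z"])
      show "finite {w. \<exists>z. poly (cpoly (pencil_at D x w)) z = 0 \<and> poly (cofp k k (pencil_at D x w)) z = 0}"
        by (rule pencil_common_root_finite_cofp) (rule D)
      show "poly (cofp k k A) z = 0" if "c \<noteq> 0" "poly (cofp k k (mscale c A)) (c * z) = 0"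
        for c z and A :: "complex^'n^'n"
        using poly_cofp_mscale[of k k c A z] that by (auto split: if_splits)
    qed
  qed
  from AE_not_in[OF this] show ?thesis by (auto elim!: eventually_mono)
qed

section \<open>Conclusion\<close>

lemma frob_eq_norm: "frob A = norm A"
  by (simp add: frob_def norm_vec_def L2_set_def sum_nonneg)

lemma gauss_mat_eq:
  fixes Qbar :: "complex^'n^'n"
  assumes "\<sigma> > 0"
  shows "gauss_mat Qbar \<sigma> = density lborel (\<lambda>Q. ennreal (gdens (\<sigma>\<^sup>2) (Q - Qbar)))"
proof -
  \<comment> \<open>The real dimension is 2 n^2, so the exponent of \<open>gdens\<close> agrees with
    the n^2 of the complex Gaussian.\<close>
  have "real DIM(complex^'n^'n) / 2 = real (CARD('n)\<^sup>2)"
    by (simp add: power2_eq_square)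
  then show ?thesis
    unfolding gauss_mat_def gdens_def frob_eq_norm by simp
qed

text \<open>Simple roots of a polynomial of degree n are n in number; this selects the finite-sum
  branch of \<open>mu_av_sq\<close>.\<close>

lemma card_eigvals:
  assumes "\<forall>z. poly (cpoly Q) z = 0 \<longrightarrow> poly (pderiv (cpoly Q)) z \<noteq> 0"
  shows "card (eigvals (Q :: complex^'n^'n)) = CARD('n)"
proof -
  have "rsquarefree (cpoly Q)" using assms by (auto simp: rsquarefree_roots)
  then have "degree (smult (lead_coeff (cpoly Q)) (\<Prod>z | poly (cpoly Q) z = 0. [:- z, 1:])) = degree (cpoly Q)"
    by (rule arg_cong[OF complex_poly_decompose_rsquarefree])
  then have "card {z. poly (cpoly Q) z = 0} = degree (cpoly Q)"
    using cpoly_nonzero[of Q] by (simp add: degree_prod_sum_eq)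
  moreover have "eigvals Q = {z. poly (cpoly Q) z = 0}" by (auto simp: eigvals_iff)
  ultimately show ?thesis by (simp add: degree_cpoly)
qed

lemma simple_roots_cofG_sum_le:
  fixes Q :: "complex^'n^'n"
  assumes simple: "\<forall>z. poly (cpoly Q) z = 0 \<longrightarrow> poly (pderiv (cpoly Q)) z \<noteq> 0"
    and nz: "\<And>z. poly (cpoly Q) z = 0 \<Longrightarrow> cofv k Q z \<noteq> 0"
  shows "(\<Sum>z\<in>eigvals Q. ennreal (cofG k Q z / (cmod (poly (pderiv (cpoly Q)) z))\<^sup>2)) \<le> root_kernel_liminf k Q"
proof -
  have ev: "eigvals Q = {z. poly (cpoly Q) z = 0}" by (auto simp: eigvals_iff)
  have c1: "continuous_on UNIV (\<lambda>z. cinner (cofv' k Q z) (cofv k Q z))"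
    "continuous_on UNIV (cofv k Q)" "continuous_on UNIV (cofv' k Q)"
    unfolding cinner_def cofv_def cofv'_def by (auto intro!: continuous_intros)
  show ?thesis
    unfolding root_kernel_liminf_def root_kernel_def
  proof (rule simple_roots_kernel_liminf)
    show "finite (eigvals Q)" unfolding ev by (rule poly_roots_finite[OF cpoly_nonzero])
    show "(\<lambda>z. poly (cpoly Q) z) \<in> borel_measurable borel"
      by (intro borel_measurable_continuous_onI continuous_intros)
    show "cofG k Q \<in> borel_measurable borel"
    proof -
      have [measurable]: "(\<lambda>z. cinner (cofv' k Q z) (cofv k Q z)) \<in> borel_measurable borel"
        "cofv k Q \<in> borel_measurable borel" "cofv' k Q \<in> borel_measurable borel"
        using c1 by (auto intro: borel_measurable_continuous_onI)
      show ?thesis unfolding cofG_def[abs_def] by measurable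
    qed
    fix a assume a: "a \<in> eigvals Q"
    show "(poly (cpoly Q) has_field_derivative poly (pderiv (cpoly Q)) a) (at a)" by (rule poly_DERIV)
    have "isCont (\<lambda>z. cinner (cofv' k Q z) (cofv k Q z)) a" "isCont (cofv k Q) a" "isCont (cofv' k Q) a"
      using c1 by (simp_all add: continuous_on_eq_continuous_at)
    \<comment> \<open>\<open>cofG\<close> divides by |v|^2, so the zoom at an eigenvalue is
      legitimate only if the curve does not vanish there.\<close>
    then show "isCont (cofG k Q) a"
      unfolding cofG_def[abs_def] using nz[of a] a ev by (intro continuous_intros) auto
  qed (use simple in \<open>auto simp: ev cofG_nonneg\<close>)
qed

lemma mu_av_sq_le:
  fixes Q :: "complex^'n^'n"
  assumes Q: "Q \<noteq> 0"
    and simple: "\<forall>z. poly (cpoly Q) z = 0 \<longrightarrow> poly (pderiv (cpoly Q)) z \<noteq> 0"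
    and nz: "\<forall>k. \<forall>z. poly (cpoly Q) z = 0 \<longrightarrow> poly (cofp k k Q) z \<noteq> 0"
  shows "mu_av_sq Q / ennreal ((frob Q)\<^sup>2)
    \<le> (\<Sum>k\<in>UNIV. root_kernel_liminf k Q) / ennreal (real CARD('n))"
proof -
  let ?v = "\<lambda>z. SOME v. v \<noteq> 0 \<and> Q *v v = z *s v"
  let ?S = "\<Sum>z\<in>eigvals Q. (inv_opnorm Q z (?v z))\<^sup>2"
  let ?F = "ennreal ((frob Q)\<^sup>2)" and ?n = "ennreal (real CARD('n))"
  have F: "?F \<noteq> 0" "?F \<noteq> top" using Q by (simp_all add: frob_eq_norm)
  have nz': "cofv k Q z \<noteq> 0" if "poly (cpoly Q) z = 0" for k z
    using nz that by (auto simp: cofv_def vec_eq_iff)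
  have "mu_av_sq Q = (\<Sum>z\<in>eigvals Q. (mu Q z (?v z))\<^sup>2) / ?n"
    unfolding mu_av_sq_def using card_eigvals[OF simple] by simp
  also have "(\<Sum>z\<in>eigvals Q. (mu Q z (?v z))\<^sup>2) = ?F * ?S"
    unfolding mu_def power_mult_distrib
    by (simp add: sum_distrib_left ennreal_power frob_eq_norm)
  finally have "mu_av_sq Q / ?F = (?F * inverse ?F) * (?S / ?n)"
    by (simp only: divide_ennreal_def mult_ac)
  \<comment> \<open>Cancellation in \<open>ennreal\<close> needs a finite nonzero factor, hence Q
    different from 0.\<close>
  also have "?F * inverse ?F = 1"
    using ennreal_divide_self[OF F(1)] F(2) by (simp add: divide_ennreal_def less_top)
  finally have "mu_av_sq Q / ?F = ?S / ?n" by simp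
  also have "?S \<le> (\<Sum>z\<in>eigvals Q. \<Sum>k\<in>UNIV. ennreal (cofG k Q z / (cmod (poly (pderiv (cpoly Q)) z))\<^sup>2))"
  proof (rule sum_mono)
    fix z assume z: "z \<in> eigvals Q"
    then have "\<exists>v. v \<noteq> 0 \<and> Q *v v = z *s v" by (simp add: eigvals_def)
    then have v: "?v z \<noteq> 0 \<and> Q *v ?v z = z *s ?v z" by (rule someI_ex)
    have p: "poly (cpoly Q) z = 0" using z by (simp add: eigvals_iff)
    show "(inv_opnorm Q z (?v z))\<^sup>2 \<le> (\<Sum>k\<in>UNIV. ennreal (cofG k Q z / (cmod (poly (pderiv (cpoly Q)) z))\<^sup>2))"
      using v by (intro inv_opnorm_square_le p nz'[OF p]) (use simple p in auto)
  qed
  also have "\<dots> = (\<Sum>k\<in>UNIV. \<Sum>z\<in>eigvals Q. ennreal (cofG k Q z / (cmod (poly (pderiv (cpoly Q)) z))\<^sup>2))"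
    by (rule sum.swap)
  also have "\<dots> \<le> (\<Sum>k\<in>UNIV. root_kernel_liminf k Q)"
    by (intro sum_mono simple_roots_cofG_sum_le simple nz')
  finally show ?thesis by (simp add: divide_right_mono_ennreal)
qed

theorem theorem2p16:
  fixes Qbar :: "complex^'n^'n" and \<sigma> :: real
  assumes "\<sigma> > 0"
  shows "(\<integral>\<^sup>+ Q. mu_av_sq Q / ennreal ((frob Q)\<^sup>2) \<partial>gauss_mat Qbar \<sigma>)
           \<le> ennreal (exp 1 * real CARD('n) / (2 * \<sigma>\<^sup>2))"
proof -
  let ?n = "real CARD('n)"
  let ?M = "density lborel (\<lambda>Q. ennreal (gdens (\<sigma>\<^sup>2) (Q - Qbar)))"
  have s: "\<sigma>\<^sup>2 > 0" using assms by simp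
  \<comment> \<open>The generic conditions are proved for Lebesgue measure and pass to the Gaussian
    because it has a density. A nonzero diagonal cofactor is a convenient witness that the whole
    column is nonzero.\<close>
  have "AE Q in (lborel :: (complex^'n^'n) measure). Q \<noteq> 0 \<and>
      (\<forall>z. poly (cpoly Q) z = 0 \<longrightarrow> poly (pderiv (cpoly Q)) z \<noteq> 0) \<and>
      (\<forall>k. \<forall>z. poly (cpoly Q) z = 0 \<longrightarrow> poly (cofp k k Q) z \<noteq> 0)"
    by (intro AE_conjI AE_lborel_singleton AE_simple_roots) (simp add: AE_all_countable AE_cofp_nonzero)
  then have "AE Q in (lborel :: (complex^'n^'n) measure). mu_av_sq Q / ennreal ((frob Q)\<^sup>2)
      \<le> (\<Sum>k\<in>UNIV. root_kernel_liminf k Q) / ennreal ?n"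
    by (rule eventually_mono) (elim conjE, rule mu_av_sq_le)
  then have "AE Q in ?M. mu_av_sq Q / ennreal ((frob Q)\<^sup>2)
      \<le> (\<Sum>k\<in>UNIV. root_kernel_liminf k Q) / ennreal ?n"
    by (subst AE_density) (simp, erule eventually_mono, rule impI)
  then have "(\<integral>\<^sup>+ Q. mu_av_sq Q / ennreal ((frob Q)\<^sup>2) \<partial>gauss_mat Qbar \<sigma>)
      \<le> (\<integral>\<^sup>+ Q. (\<Sum>k\<in>UNIV. root_kernel_liminf k Q) / ennreal ?n \<partial>?M)"
    unfolding gauss_mat_eq[OF assms] by (rule nn_integral_mono_AE)
  also have "\<dots> = (\<integral>\<^sup>+ Q. (\<Sum>k\<in>UNIV. root_kernel_liminf k Q) \<partial>?M) / ennreal ?n"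
    by (rule nn_integral_divide) measurable
  also have "(\<integral>\<^sup>+ Q. (\<Sum>k\<in>UNIV. root_kernel_liminf k Q) \<partial>?M)
      = (\<Sum>k\<in>UNIV. \<integral>\<^sup>+ Q. root_kernel_liminf k Q \<partial>?M)"
    by (rule nn_integral_sum) measurable
  \<comment> \<open>Each of the n indices contributes at most (n - 1) / \<open>\<sigma>\<close>^2,
    and the average over n eigenvalues divides the total by n.\<close>
  also have "\<dots> \<le> (\<Sum>k\<in>(UNIV :: 'n set). ennreal (real (CARD('n) - 1) / \<sigma>\<^sup>2))"
  proof (rule sum_mono)
    fix k :: 'n
    show "(\<integral>\<^sup>+ Q. root_kernel_liminf k Q \<partial>?M) \<le> ennreal (real (CARD('n) - 1) / \<sigma>\<^sup>2)"
      using root_kernel_liminf_expectation[OF s, of Qbar k]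
      by (subst nn_integral_density) simp_all
  qed
  also have "(\<Sum>k\<in>(UNIV :: 'n set). ennreal (real (CARD('n) - 1) / \<sigma>\<^sup>2))
      = ennreal (?n * (real (CARD('n) - 1) / \<sigma>\<^sup>2))"
    by (subst sum_ennreal) simp_all
  also have "\<dots> / ennreal ?n = ennreal (real (CARD('n) - 1) / \<sigma>\<^sup>2)"
    by (subst divide_ennreal) simp_all
  also have "\<dots> \<le> ennreal (exp 1 * ?n / (2 * \<sigma>\<^sup>2))"
  proof (rule ennreal_leI)
    \<comment> \<open>The constant e enters only here, through e >= 1 + 1 and n - 1 <= n.\<close>
    have "2 * real (CARD('n) - 1) \<le> exp 1 * ?n"
      using exp_ge_add_one_self[of 1] by (intro mult_mono) auto
    then have "2 * real (CARD('n) - 1) / (2 * \<sigma>\<^sup>2) \<le> exp 1 * ?n / (2 * \<sigma>\<^sup>2)"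
      by (rule divide_right_mono) simp
    then show "real (CARD('n) - 1) / \<sigma>\<^sup>2 \<le> exp 1 * ?n / (2 * \<sigma>\<^sup>2)"
      by (simp only: mult_divide_mult_cancel_left_if) simp
  qed
  finally show ?thesis by (simp add: divide_right_mono_ennreal)
qed

end
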